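(* Let $\gamma\in(0,1)$, $d\ge1$ an integer, and let $x=(x^1,\dots,x^d)\colon[0,T]\to\mathbb R^d$ be a $\gamma$-H\"older path such that there exists a $\gamma$-quasi-geometric rough path $\mathbb X$ associated to $\hat T(\mathbb A^d_\gamma)$ over $x$, i.e. with $\langle\mathbb X_{st},e_i\rangle=x^i_t-x^i_s$ for $i=1,\dots,d$. Then for any $\varphi\in C^{N_\gamma+1}_b(\mathbb R^d,\mathbb R)$ and $s,t\in[0,T]$ one has $$\varphi(x_t)=\varphi(x_s)+\sum_{n=1}^{N_\gamma}\ \sum_{k\in\mathbb N^d,\,|k|=n}\frac1{k!}\int_s^t\partial^k\Phi(X_r)\,d^g\mathbb X^k_r ,$$ where $\partial^k\Phi(X)$ is the weighted controlled rough path obtained by composing the path $X$ with $\partial^k\varphi$.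
   Context: $N_\gamma=\lfloor\gamma^{-1}\rfloor$. $C^m_b(\mathbb R^d,\mathbb R)$ is the set of functions whose partial derivatives up to order $m$ are continuous and bounded. For $k\in\mathbb N^d$: $|k|=\sum k_i$, $k!=\prod k_i!$, $\partial^k=\partial_1^{k_1}\cdots\partial_d^{k_d}$. $\mathbb A^d_\gamma=\{\alpha\in\mathbb N^d\setminus\{0\}:|\alpha|\le N_\gamma\}$, $e_1,\dots,e_d$ is the canonical basis of $\mathbb N^d$; $W(\mathbb A^d_\gamma)$ is the set of words in these letters (including the empty word $\mathbf 1$), $T(\mathbb A^d_\gamma)$ the free real vector space on it. The commutative bracket is the bilinear map on $\mathbb R^{\mathbb A^d_\gamma}$ with $[\alpha,\beta]_\gamma=\alpha+\beta$ if $\alpha+\beta\in\mathbb A^d_\gamma$ and $0$ otherwise. The quasi-shuffle product $\widehat{\sqcup\!\sqcup}_\gamma$ has unit $\mathbf 1$ and satisfies $va\,\widehat{\sqcup\!\sqcup}_\gamma\,wb=(v\,\widehat{\sqcup\!\sqcup}_\gamma\,wb)a+(va\,\widehat{\sqcup\!\sqcup}_\gamma\,w)b+(v\,\widehat{\sqcup\!\sqcup}_\gamma\,w)[a,b]_\gamma$ for words $v,w$ and letters $a,b$; $\hat T(\mathbb A^d_\gamma)$ is $T(\mathbb A^d_\gamma)$ with this product and the deconcatenation coproduct $\nabla(a_1\cdots a_m)=\sum_{i=0}^m a_1\cdots a_i\otimes a_{i+1}\cdots a_m$. The weight is $\Vert\alpha_1\cdots\alpha_l\Vert_\gamma=\sum_j|\alpha_j|$,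 $\Vert\mathbf 1\Vert_\gamma=0$. A $\gamma$-quasi-geometric rough path associated to $\hat T(\mathbb A^d_\gamma)$ is a function $\mathbb X\colon[0,T]^2\to(T^{N_\gamma})^*$, $T^{N_\gamma}$ the span of words with $\Vert w\Vert_\gamma\le N_\gamma$, such that: $\langle\mathbb X_{st},x\,\widehat{\sqcup\!\sqcup}_\gamma\,y\rangle=\langle\mathbb X_{st},x\rangle\langle\mathbb X_{st},y\rangle$ whenever $x,y,x\,\widehat{\sqcup\!\sqcup}_\gamma\,y\in T^{N_\gamma}$; $\mathbb X_{su}*\mathbb X_{ut}=\mathbb X_{st}$ for all $s,u,t\in[0,T]$, where $\langle\alpha*\beta,h\rangle=\langle\alpha\otimes\beta,\nabla h\rangle$; and $\sup_{s\ne t}|\langle\mathbb X_{st},w\rangle||t-s|^{-\gamma\Vert w\Vert_\gamma}<\infty$ for every word $w$ with $\Vert w\Vert_\gamma\le N_\gamma$. The path $X=(X^1,\dots,X^d)$ is $X^i_t=x^i_t\mathbf 1+e_i$. For $|k|=n$, set $M=N_\gamma+1-n$; the composition of $X$ with $\partial^k\varphi\in C^M_b$ is $$\partial^k\Phi(X_t)=\sum_{l\in\mathbb N^d}\frac{\partial^l(\partial^k\varphi)(x_t)}{l!}\big[e_1^{\widehat{\sqcup\!\sqcup}_\gamma l_1}\,\widehat{\sqcup\!\sqcup}_\gamma\cdots\widehat{\sqcup\!\sqcup}_\gamma\,e_d^{\widehat{\sqcup\!\sqcup}_\gamma l_d}\big]_{<M},$$ where $[\cdot]_{<M}$ is the projection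 onto the span of words $w$ with $\Vert w\Vert_\gamma<M$ (so only $|l|<M$ contributes). For such a path $Y=\partial^k\Phi(X)$, the rough integral is $$\int_0^tY_r\,d^g\mathbb X^k_r=\lim_{|\pi|\to0}\sum_{[u,v]\in\pi}\ \sum_{w\in W(\mathbb A^d_\gamma),\,\Vert w\Vert_\gamma\le N_\gamma-|k|}\langle w^*,Y_u\rangle\langle\mathbb X_{uv},wk\rangle,$$ where $\pi$ ranges over partitions of $[0,t]$ with mesh $|\pi|\to0$, $\langle w^*,Y_u\rangle$ is the coefficient of the word $w$ in $Y_u$, and $wk$ is $w$ followed by the letter $k$; and $\int_s^t=\int_0^t-\int_0^s$. *)

theory Defs
  imports "HOL-Analysis.Analysis" "HOL-Library.Poly_Mapping"
begin

(* The dimension d is CARD('d).  The linear order on the index type 'd only serves to write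
   ordered products over the coordinates 1, ..., d. *)

section \<open>Multi-indices and partial derivatives\<close>

type_synonym 'd mindex = "nat ^ 'd"

type_synonym 'd point = "real ^ 'd"

definition coords :: "'d::{finite,linorder} list" where
  "coords = sorted_list_of_set UNIV"

definition mdeg :: "('d::finite) mindex \<Rightarrow> nat" where
  "mdeg k = (\<Sum>i\<in>UNIV. k $ i)"

definition mfact :: "('d::finite) mindex \<Rightarrow> nat" where
  "mfact k = (\<Prod>i\<in>UNIV. fact (k $ i))"

definition partial :: "'d::finite \<Rightarrow> ('d point \<Rightarrow> real) \<Rightarrow> 'd point \<Rightarrow> real" where
  "partial i f y = deriv (\<lambda>h. f (y + h *\<^sub>R axis i 1)) 0"

definition has_partial :: "'d::finite \<Rightarrow> ('d point \<Rightarrow> real) \<Rightarrow> bool" where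
  "has_partial i f \<longleftrightarrow> (\<forall>y. (\<lambda>h. f (y + h *\<^sub>R axis i 1)) field_differentiable (at 0))"

definition mpartial :: "('d::{finite,linorder}) mindex \<Rightarrow> ('d point \<Rightarrow> real) \<Rightarrow> 'd point \<Rightarrow> real" where
  "mpartial k f = foldr (\<lambda>i. partial i ^^ (k $ i)) coords f"

primrec Cb :: "nat \<Rightarrow> (('d::finite) point \<Rightarrow> real) set" where
  "Cb 0 = {f. continuous_on UNIV f \<and> bounded (range f)}"
| "Cb (Suc m) = {f. continuous_on UNIV f \<and> bounded (range f) \<and>
                    (\<forall>i. has_partial i f \<and> partial i f \<in> Cb m)}"

section \<open>Words and the quasi-shuffle algebra\<close>

type_synonym 'd word = "'d mindex list"

(* Elements of the free real vector space on words are finitely supported functions. *)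

instantiation poly_mapping :: (type, real_vector) real_vector
begin

definition scaleR_poly_mapping :: "real \<Rightarrow> ('a \<Rightarrow>\<^sub>0 'b) \<Rightarrow> 'a \<Rightarrow>\<^sub>0 'b" where
  "scaleR_poly_mapping c = Poly_Mapping.map ((*\<^sub>R) c)"

lemma lookup_scaleR: "Poly_Mapping.lookup (c *\<^sub>R x) a = c *\<^sub>R Poly_Mapping.lookup x a"
  for x :: "'a \<Rightarrow>\<^sub>0 'b"
  by (auto simp: scaleR_poly_mapping_def Poly_Mapping.map.rep_eq when_def)

instance
  by standard (auto intro!: poly_mapping_eqI simp: lookup_scaleR lookup_add algebra_simps)

end

abbreviation word_vec :: "'d word \<Rightarrow> 'd word \<Rightarrow>\<^sub>0 real" where
  "word_vec w \<equiv> Poly_Mapping.single w 1"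

definition Ngam :: "real \<Rightarrow> nat" where
  "Ngam \<gamma> = nat \<lfloor>inverse \<gamma>\<rfloor>"

definition alphabet :: "real \<Rightarrow> ('d::finite) mindex set" where
  "alphabet \<gamma> = {\<alpha>. \<alpha> \<noteq> 0 \<and> mdeg \<alpha> \<le> Ngam \<gamma>}"

definition words :: "real \<Rightarrow> ('d::finite) word set" where
  "words \<gamma> = lists (alphabet \<gamma>)"

definition weight :: "('d::finite) word \<Rightarrow> nat" where
  "weight w = sum_list (map mdeg w)"

definition bracket :: "real \<Rightarrow> ('d::finite) mindex \<Rightarrow> 'd mindex \<Rightarrow> 'd mindex \<Rightarrow>\<^sub>0 real" where
  "bracket \<gamma> a b = (if a + b \<in> alphabet \<gamma> then Poly_Mapping.single (a + b) 1 else 0)"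

(* The bilinear extension of (w, a) \<mapsto> wa. *)
definition append_letter :: "('d word \<Rightarrow>\<^sub>0 real) \<Rightarrow> ('d mindex \<Rightarrow>\<^sub>0 real) \<Rightarrow> 'd word \<Rightarrow>\<^sub>0 real" where
  "append_letter x c = (\<Sum>w\<in>Poly_Mapping.keys x. \<Sum>a\<in>Poly_Mapping.keys c.
      (Poly_Mapping.lookup x w * Poly_Mapping.lookup c a) *\<^sub>R word_vec (w @ [a]))"

function qsh_word :: "real \<Rightarrow> ('d::finite) word \<Rightarrow> 'd word \<Rightarrow> 'd word \<Rightarrow>\<^sub>0 real" where
  "qsh_word \<gamma> v w =
     (if v = [] then word_vec w
      else if w = [] then word_vec v
      else append_letter (qsh_word \<gamma> (butlast v) w) (Poly_Mapping.single (last v) 1)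
         + append_letter (qsh_word \<gamma> v (butlast w)) (Poly_Mapping.single (last w) 1)
         + append_letter (qsh_word \<gamma> (butlast v) (butlast w)) (bracket \<gamma> (last v) (last w)))"
  by auto
termination
  by (relation "Wellfounded.measure (\<lambda>(\<gamma>, v, w). length v + length w)") (auto intro!: add_less_mono)

declare qsh_word.simps [simp del]

lemma qsh_word_rec:
  "qsh_word \<gamma> [] w = word_vec w"
  "qsh_word \<gamma> w [] = word_vec w"
  "qsh_word \<gamma> (v @ [a]) (w @ [b]) =
     append_letter (qsh_word \<gamma> v (w @ [b])) (Poly_Mapping.single a 1)
   + append_letter (qsh_word \<gamma> (v @ [a]) w) (Poly_Mapping.single b 1)
   + append_letter (qsh_word \<gamma> v w) (bracket \<gamma> a b)"
  by (simp_all add: qsh_word.simps[of \<gamma> "[]"] qsh_word.simps[of \<gamma> w "[]"]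
        qsh_word.simps[of \<gamma> "v @ [a]" "w @ [b]"])

definition qshuffle :: "real \<Rightarrow> (('d::finite) word \<Rightarrow>\<^sub>0 real) \<Rightarrow> ('d word \<Rightarrow>\<^sub>0 real) \<Rightarrow> 'd word \<Rightarrow>\<^sub>0 real" where
  "qshuffle \<gamma> x y = (\<Sum>v\<in>Poly_Mapping.keys x. \<Sum>w\<in>Poly_Mapping.keys y.
      (Poly_Mapping.lookup x v * Poly_Mapping.lookup y w) *\<^sub>R qsh_word \<gamma> v w)"

primrec qsh_power :: "real \<Rightarrow> (('d::finite) word \<Rightarrow>\<^sub>0 real) \<Rightarrow> nat \<Rightarrow> 'd word \<Rightarrow>\<^sub>0 real" where
  "qsh_power \<gamma> x 0 = word_vec []"
| "qsh_power \<gamma> x (Suc n) = qshuffle \<gamma> x (qsh_power \<gamma> x n)"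

definition qsh_monomial :: "real \<Rightarrow> ('d::{finite,linorder}) mindex \<Rightarrow> 'd word \<Rightarrow>\<^sub>0 real" where
  "qsh_monomial \<gamma> l =
     foldr (\<lambda>i. qshuffle \<gamma> (qsh_power \<gamma> (word_vec [axis i 1]) (l $ i))) coords (word_vec [])"

(* The tensor square of the word space is the free vector space on pairs of words. *)
definition deconcat :: "('d word \<Rightarrow>\<^sub>0 real) \<Rightarrow> 'd word \<times> 'd word \<Rightarrow>\<^sub>0 real" where
  "deconcat x = (\<Sum>w\<in>Poly_Mapping.keys x. Poly_Mapping.lookup x w *\<^sub>R
      (\<Sum>i\<le>length w. Poly_Mapping.single (take i w, drop i w) 1))"

section \<open>Quasi-geometric rough paths\<close>

definition trunc_space :: "real \<Rightarrow> (('d::finite) word \<Rightarrow>\<^sub>0 real) set" where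
  "trunc_space \<gamma> = span (word_vec ` {w \<in> words \<gamma>. weight w \<le> Ngam \<gamma>})"

(* A linear functional on trunc_space is modelled by a total function;
   its values outside trunc_space are irrelevant. *)
definition trunc_dual :: "real \<Rightarrow> ((('d::finite) word \<Rightarrow>\<^sub>0 real) \<Rightarrow> real) set" where
  "trunc_dual \<gamma> = {f. (\<forall>x\<in>trunc_space \<gamma>. \<forall>y\<in>trunc_space \<gamma>. f (x + y) = f x + f y) \<and>
                      (\<forall>c. \<forall>x\<in>trunc_space \<gamma>. f (c *\<^sub>R x) = c * f x)}"

definition tensor_pairing ::
  "(('d word \<Rightarrow>\<^sub>0 real) \<Rightarrow> real) \<Rightarrow> (('d word \<Rightarrow>\<^sub>0 real) \<Rightarrow> real) \<Rightarrow> ('d word \<times> 'd word \<Rightarrow>\<^sub>0 real) \<Rightarrow> real" where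
  "tensor_pairing f g z = (\<Sum>(u, v)\<in>Poly_Mapping.keys z.
      Poly_Mapping.lookup z (u, v) * (f (word_vec u) * g (word_vec v)))"

definition convolution ::
  "(('d word \<Rightarrow>\<^sub>0 real) \<Rightarrow> real) \<Rightarrow> (('d word \<Rightarrow>\<^sub>0 real) \<Rightarrow> real) \<Rightarrow> ('d word \<Rightarrow>\<^sub>0 real) \<Rightarrow> real" where
  "convolution f g h = tensor_pairing f g (deconcat h)"

definition quasi_geometric_rough_path ::
  "real \<Rightarrow> real \<Rightarrow> (real \<Rightarrow> real \<Rightarrow> (('d::finite) word \<Rightarrow>\<^sub>0 real) \<Rightarrow> real) \<Rightarrow> bool" where
  "quasi_geometric_rough_path \<gamma> T X \<longleftrightarrow>
     (\<forall>s\<in>{0..T}. \<forall>t\<in>{0..T}. X s t \<in> trunc_dual \<gamma>) \<and>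
     (\<forall>s\<in>{0..T}. \<forall>t\<in>{0..T}. \<forall>x\<in>trunc_space \<gamma>. \<forall>y\<in>trunc_space \<gamma>.
        qshuffle \<gamma> x y \<in> trunc_space \<gamma> \<longrightarrow> X s t (qshuffle \<gamma> x y) = X s t x * X s t y) \<and>
     (\<forall>s\<in>{0..T}. \<forall>u\<in>{0..T}. \<forall>t\<in>{0..T}. \<forall>h\<in>trunc_space \<gamma>.
        convolution (X s u) (X u t) h = X s t h) \<and>
     (\<forall>w\<in>words \<gamma>. weight w \<le> Ngam \<gamma> \<longrightarrow>
        bdd_above {\<bar>X s t (word_vec w)\<bar> * \<bar>t - s\<bar> powr (- (\<gamma> * real (weight w))) |s t.
                     s \<in> {0..T} \<and> t \<in> {0..T} \<and> s \<noteq> t})"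

definition holder_path :: "real \<Rightarrow> real \<Rightarrow> (real \<Rightarrow> ('d::finite) point) \<Rightarrow> bool" where
  "holder_path \<gamma> T x \<longleftrightarrow>
     (\<exists>C. \<forall>s\<in>{0..T}. \<forall>t\<in>{0..T}. norm (x t - x s) \<le> C * \<bar>t - s\<bar> powr \<gamma>)"

section \<open>Composition and rough integration\<close>

definition proj_less :: "nat \<Rightarrow> (('d::finite) word \<Rightarrow>\<^sub>0 real) \<Rightarrow> 'd word \<Rightarrow>\<^sub>0 real" where
  "proj_less M x = (\<Sum>w | w \<in> Poly_Mapping.keys x \<and> weight w < M.
      Poly_Mapping.lookup x w *\<^sub>R word_vec w)"

(* Composition of \<psi> in C^M_b with the path of components x^i_t 1 + e_i.  Every word in
   qsh_monomial \<gamma> l has weight mdeg l, so the terms with mdeg l \<ge> M of the Taylor sum vanish. *)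
definition compose_path ::
  "real \<Rightarrow> nat \<Rightarrow> ('d point \<Rightarrow> real) \<Rightarrow> (real \<Rightarrow> 'd point) \<Rightarrow> real \<Rightarrow> ('d::{finite,linorder}) word \<Rightarrow>\<^sub>0 real" where
  "compose_path \<gamma> M \<psi> x t = (\<Sum>l | mdeg l < M.
      (mpartial l \<psi> (x t) / real (mfact l)) *\<^sub>R proj_less M (qsh_monomial \<gamma> l))"

definition deriv_path ::
  "real \<Rightarrow> ('d point \<Rightarrow> real) \<Rightarrow> (real \<Rightarrow> 'd point) \<Rightarrow> 'd mindex \<Rightarrow> real \<Rightarrow> ('d::{finite,linorder}) word \<Rightarrow>\<^sub>0 real" where
  "deriv_path \<gamma> \<phi> x k = compose_path \<gamma> (Ngam \<gamma> + 1 - mdeg k) (mpartial k \<phi>) x"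

(* A partition of [0,t] is the list of its points 0 = t_0 < ... < t_n = t; for t = 0 it is [0]. *)
definition partitions :: "real \<Rightarrow> real list set" where
  "partitions t = {ts. ts \<noteq> [] \<and> sorted_wrt (<) ts \<and> hd ts = 0 \<and> last ts = t}"

definition mesh_filter :: "real \<Rightarrow> real list filter" where
  "mesh_filter t = (INF \<delta>\<in>{0<..}. principal
     {ts \<in> partitions t. \<forall>j < length ts - 1. ts ! Suc j - ts ! j < \<delta>})"

definition rough_sum ::
  "real \<Rightarrow> (real \<Rightarrow> real \<Rightarrow> (('d::finite) word \<Rightarrow>\<^sub>0 real) \<Rightarrow> real) \<Rightarrow> 'd mindex \<Rightarrow>
   (real \<Rightarrow> 'd word \<Rightarrow>\<^sub>0 real) \<Rightarrow> real list \<Rightarrow> real" where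
  "rough_sum \<gamma> X k Y ts = (\<Sum>j < length ts - 1.
      \<Sum>w | w \<in> words \<gamma> \<and> weight w \<le> Ngam \<gamma> - mdeg k.
        Poly_Mapping.lookup (Y (ts ! j)) w * X (ts ! j) (ts ! Suc j) (word_vec (w @ [k])))"

definition rough_integrable ::
  "real \<Rightarrow> (real \<Rightarrow> real \<Rightarrow> (('d::finite) word \<Rightarrow>\<^sub>0 real) \<Rightarrow> real) \<Rightarrow> 'd mindex \<Rightarrow>
   (real \<Rightarrow> 'd word \<Rightarrow>\<^sub>0 real) \<Rightarrow> real \<Rightarrow> bool" where
  "rough_integrable \<gamma> X k Y t \<longleftrightarrow> (\<exists>I. (rough_sum \<gamma> X k Y \<longlongrightarrow> I) (mesh_filter t))"

(* Meaningful only under rough_integrable. *)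
definition rough_integral ::
  "real \<Rightarrow> (real \<Rightarrow> real \<Rightarrow> (('d::finite) word \<Rightarrow>\<^sub>0 real) \<Rightarrow> real) \<Rightarrow> 'd mindex \<Rightarrow>
   (real \<Rightarrow> 'd word \<Rightarrow>\<^sub>0 real) \<Rightarrow> real \<Rightarrow> real \<Rightarrow> real" where
  "rough_integral \<gamma> X k Y s t =
     Lim (mesh_filter t) (rough_sum \<gamma> X k Y) - Lim (mesh_filter s) (rough_sum \<gamma> X k Y)"

end

theory Submission
  imports Defs
begin

text \<open>
Let \<open>N = Ngam \<gamma>\<close>. The proof rests on one algebraic fact. The monomial of multi-index \<open>l\<close> in the letters
\<open>e_i\<close>, formed with the quasi-shuffle product and divided by \<open>l!\<close>, is the sum of all words whose letters add
up to \<open>l\<close>, and the coefficient of the word is the product of the \<open>1 / a!\<close> over its letters \<open>a\<close>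
(\<open>qsh_monomial_divpow\<close>, a consequence of the multiplication rule \<open>qshuffle_divpow\<close>). These coefficients are
multiplicative under concatenation. A rough path respects the product and is given by the increments of the
path on the letters \<open>e_i\<close>, so its value on such a divided power is a divided monomial in the increments
(\<open>rough_path_compositions\<close>). Expansions over words therefore collapse to Taylor polynomials.

The consequences for the summands of the rough sums, called germs here, are the following. The coefficient
of a word \<open>w\<close> in the composition with \<open>\<partial>^k \<phi>\<close> is the derivative of \<open>\<phi>\<close> of index \<open>k\<close> plus the sum of \<open>w\<close>,
times the coefficient of \<open>w\<close> above; this uses that partial derivatives commute.

Each integral exists. By Chen's relation and multiplicativity, the defect of additivity of a germ is a
combination of Taylor remainders of derivatives of \<open>\<phi>\<close> (\<open>germ_almost_additive_identity\<close>), and all orders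
add up to \<open>\<gamma> * (N + 1)\<close>, which exceeds \<open>1\<close> (\<open>germ_almost_additive\<close>). The sewing lemma (\<open>sewing\<close>) then
shows that the sums over partitions converge.

The integrals add up to the increment. Every nonempty word is \<open>w @ [k]\<close> for exactly one \<open>w\<close> and \<open>k\<close>, so
the germs, weighted by \<open>1 / k!\<close>, sum up to the Taylor expansion of \<open>\<phi>\<close> of order \<open>N\<close> without its constant
term (\<open>sum_germs_taylor\<close>). This is the increment of \<open>\<phi>\<close> along the path up to an error of order
\<open>\<gamma> * (N + 1) > 1\<close>, and such errors vanish in the limit, where the increments telescope
(\<open>psum_tendsto_increment\<close>).

A degenerate case stands apart: the functionals may vanish identically, including on the empty word. Then
the path is constant and all integrals are zero (\<open>rough_path_dichotomy\<close>).
\<close>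

section \<open>Multi-indices\<close>

lemma mdeg_0 [simp]: "mdeg 0 = 0"
  by (simp add: mdeg_def)

lemma mdeg_add [simp]: "mdeg (a + b) = mdeg a + mdeg b"
  by (simp add: mdeg_def sum.distrib)

lemma mdeg_axis [simp]: "mdeg (axis i 1) = 1" "mdeg (axis i (Suc 0)) = 1"
  by (simp_all add: mdeg_def axis_def)

lemma mdeg_eq_0_iff [simp]: "mdeg k = 0 \<longleftrightarrow> k = 0"
  by (simp add: mdeg_def vec_eq_iff)

lemma finite_mdeg_le [simp]: "finite {k :: 'd::finite mindex. mdeg k \<le> n}"
proof (rule finite_subset)
  show "{k :: 'd mindex. mdeg k \<le> n} \<subseteq> vec_lambda ` (PiE UNIV (\<lambda>_. {..n}))"
  proof
    fix k :: "'d mindex" assume "k \<in> {k. mdeg k \<le> n}"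
    then have "k $ i \<le> n" for i
      using member_le_sum[of i UNIV "\<lambda>i. k $ i"] by (auto simp: mdeg_def)
    then have "(\<lambda>i. k $ i) \<in> PiE UNIV (\<lambda>_. {..n})" by auto
    moreover have "k = vec_lambda (\<lambda>i. k $ i)" by simp
    ultimately show "k \<in> vec_lambda ` (PiE UNIV (\<lambda>_. {..n}))" by blast
  qed
qed (auto intro!: finite_imageI finite_PiE)

lemma finite_mdeg_less [simp]: "finite {k :: 'd::finite mindex. mdeg k < n}"
  by (rule finite_subset[OF _ finite_mdeg_le[of n]]) auto

lemma mindex_diff_axis: "0 < l $ i \<Longrightarrow> l - axis i 1 + axis i 1 = (l :: 'd::finite mindex)"
  by (auto simp: vec_eq_iff axis_def)

lemma mindex_induct [case_names zero add]:
  fixes l :: "'d::finite mindex"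
  assumes "P 0" and "\<And>l i. P l \<Longrightarrow> P (l + axis i 1)"
  shows "P l"
proof (induction "mdeg l" arbitrary: l)
  case 0
  then show ?case using assms(1) by simp
next
  case (Suc n)
  then have "l \<noteq> 0" by auto
  then obtain i where i: "0 < l $ i" by (auto simp: vec_eq_iff)
  have l: "l - axis i 1 + axis i 1 = l" by (rule mindex_diff_axis[OF i])
  then have "mdeg l = mdeg (l - axis i 1) + 1" by (metis mdeg_add mdeg_axis(1))
  then show ?case using Suc assms(2)[of "l - axis i 1" i] l by simp
qed

text \<open>The factor \<open>1 / l!\<close> is built into the monomial, so that differentiating in direction \<open>i\<close>
merely lowers the index by \<open>axis i 1\<close>, and so that its values at the increments of the path are those
of the rough path on the divided powers of the letters.\<close>

definition divmon :: "'d::finite point \<Rightarrow> 'd mindex \<Rightarrow> real" where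
  "divmon z l = (\<Prod>i\<in>UNIV. (z $ i) ^ (l $ i) / fact (l $ i))"

lemma mfact_pos [simp]: "0 < mfact l"
  by (auto simp: mfact_def intro!: prod_pos)

lemma mfact_nonzero [simp]: "mfact l \<noteq> 0"
  using mfact_pos[of l] by linarith

lemma mfact_0 [simp]: "mfact 0 = 1"
  by (simp add: mfact_def)

lemma mfact_axis [simp]: "mfact (axis i 1) = 1" "mfact (axis i (Suc 0)) = 1"
  unfolding mfact_def by (rule prod.neutral; simp add: axis_def)+

lemma divmon_0_right [simp]: "divmon z 0 = 1"
  by (simp add: divmon_def)

lemma divmon_0_left: "divmon 0 l = (if l = 0 then 1 else 0)"
proof (cases "l = 0")
  case False
  then obtain i where "0 < l $ i" by (auto simp: vec_eq_iff)
  then have "\<exists>i\<in>UNIV. (0 :: 'a point) $ i ^ (l $ i) / fact (l $ i) = 0" by (intro bexI[of _ i]) auto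
  then show ?thesis using False by (simp add: divmon_def)
qed auto

lemma divmon_split:
  "divmon z l = (z $ i) ^ (l $ i) / fact (l $ i) * (\<Prod>j\<in>UNIV - {i}. (z $ j) ^ (l $ j) / fact (l $ j))"
  unfolding divmon_def by (rule prod.remove) auto

lemma DERIV_power_fact_Suc:
  "((\<lambda>h. (a + h) ^ Suc n / fact (Suc n)) has_field_derivative (a + h) ^ n / fact n) (at (h::real))"
  by (auto intro!: derivative_eq_intros simp: divide_simps simp del: power_Suc)

lemma divmon_along_axis:
  "divmon (z + h *\<^sub>R axis i 1) l = (z $ i + h) ^ (l $ i) / fact (l $ i)
     * (\<Prod>j\<in>UNIV - {i}. (z $ j) ^ (l $ j) / fact (l $ j))"
  unfolding divmon_split[of _ _ i] by (auto simp: axis_def intro!: prod.cong)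

lemma divmon_deriv_Suc:
  "((\<lambda>h. divmon (z + h *\<^sub>R axis i 1) (l + axis i 1)) has_field_derivative
     divmon (z + h *\<^sub>R axis i 1) l) (at h)"
proof -
  have "(\<Prod>j\<in>UNIV - {i}. (z $ j) ^ ((l + axis i 1) $ j) / fact ((l + axis i 1) $ j))
      = (\<Prod>j\<in>UNIV - {i}. (z $ j) ^ (l $ j) / fact (l $ j) :: real)"
    by (intro prod.cong) (auto simp: axis_def)
  moreover have "(l + axis i 1) $ i = Suc (l $ i)" by simp
  ultimately show ?thesis
    unfolding divmon_along_axis
    by (simp only:) (rule DERIV_cmult_right[OF DERIV_power_fact_Suc])
qed

lemma divmon_deriv_0:
  "l $ i = 0 \<Longrightarrow> ((\<lambda>h. divmon (z + h *\<^sub>R axis i 1) l) has_field_derivative 0) (at h)"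
  unfolding divmon_along_axis by simp

section \<open>Partial derivatives and Taylor's formula\<close>

lemma has_partialD:
  assumes "has_partial i f"
  shows "((\<lambda>h. f (y + h *\<^sub>R axis i 1)) has_field_derivative partial i f (y + h *\<^sub>R axis i 1)) (at h)"
proof -
  have "((\<lambda>a. f ((y + h *\<^sub>R axis i 1) + a *\<^sub>R axis i 1)) has_field_derivative
          partial i f (y + h *\<^sub>R axis i 1)) (at 0)"
    using assms unfolding has_partial_def partial_def by (blast intro: field_differentiable_derivI)
  then have "((\<lambda>a. (\<lambda>b. f (y + b *\<^sub>R axis i 1)) (a + h)) has_field_derivative
          partial i f (y + h *\<^sub>R axis i 1)) (at 0)"
    by (simp add: algebra_simps)
  then show ?thesis
    using DERIV_shift[of "\<lambda>b. f (y + b *\<^sub>R axis i 1)" _ 0 h] by simp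
qed

lemma has_partialI:
  assumes "\<And>y. ((\<lambda>h. f (y + h *\<^sub>R axis i 1)) has_field_derivative g y) (at 0)"
  shows "has_partial i f" "partial i f = g"
  using assms DERIV_imp_deriv[OF assms]
  by (auto simp: has_partial_def partial_def field_differentiable_def)

lemma Cb_mono: "Cb (Suc m) \<subseteq> Cb m"
  by (induction m) auto

lemma Cb_le: "m \<le> n \<Longrightarrow> Cb n \<subseteq> Cb m"
  by (induction n) (use Cb_mono in \<open>auto simp: le_Suc_eq simp del: Cb.simps\<close>)

lemma Cb_imp: "f \<in> Cb m \<Longrightarrow> continuous_on UNIV f \<and> bounded (range f)"
  by (cases m) auto

text \<open>The left-hand side is symmetric in \<open>i\<close> and \<open>j\<close>. The mean value theorem, first in direction \<open>i\<close> for the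
difference of two parallel restrictions of \<open>f\<close> and then in direction \<open>j\<close>, turns it into a value of one of
the two mixed derivatives; exchanging \<open>i\<close> and \<open>j\<close> gives a value of the other one.\<close>

lemma double_difference_mvt:
  assumes i: "has_partial i f" and ji: "has_partial j (partial i f)" and h: "0 < h"
  shows "\<exists>a b. 0 < a \<and> a < h \<and> 0 < b \<and> b < h \<and>
    f (y + h *\<^sub>R axis i 1 + h *\<^sub>R axis j 1) - f (y + h *\<^sub>R axis i 1) - f (y + h *\<^sub>R axis j 1) + f y
      = h * h * partial j (partial i f) (y + a *\<^sub>R axis i 1 + b *\<^sub>R axis j 1)"
proof -
  let ?g = "\<lambda>a. f ((y + h *\<^sub>R axis j 1) + a *\<^sub>R axis i 1) - f (y + a *\<^sub>R axis i 1)"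
  have "\<exists>a>0. a < h \<and> ?g h - ?g 0 = (h - 0) *
      (partial i f ((y + h *\<^sub>R axis j 1) + a *\<^sub>R axis i 1) - partial i f (y + a *\<^sub>R axis i 1))"
    using h by (intro MVT2) (auto intro!: DERIV_diff has_partialD i)
  then obtain a where a: "0 < a" "a < h" and ga: "?g h - ?g 0 = h *
      (partial i f ((y + h *\<^sub>R axis j 1) + a *\<^sub>R axis i 1) - partial i f (y + a *\<^sub>R axis i 1))"
    by auto
  let ?k = "\<lambda>b. partial i f ((y + a *\<^sub>R axis i 1) + b *\<^sub>R axis j 1)"
  have "\<exists>b>0. b < h \<and> ?k h - ?k 0 = (h - 0) *
      partial j (partial i f) ((y + a *\<^sub>R axis i 1) + b *\<^sub>R axis j 1)"
    using h by (intro MVT2) (auto intro!: has_partialD ji)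
  then obtain b where b: "0 < b" "b < h" and kb: "?k h - ?k 0 = h *
      partial j (partial i f) ((y + a *\<^sub>R axis i 1) + b *\<^sub>R axis j 1)"
    by auto
  show ?thesis
    using a b ga kb by (intro exI[of _ a] exI[of _ b]) (simp add: algebra_simps)
qed

text \<open>For each step size, both mixed derivatives take a common value at two points close to \<open>y\<close>, the
normalised second difference. Continuity of both carries the equality over to \<open>y\<close>.\<close>

lemma partial_commute:
  assumes f: "f \<in> Cb (Suc (Suc m))"
  shows "partial i (partial j f) = partial j (partial i f)"
proof
  fix y
  have P: "has_partial i f" "has_partial j f" "has_partial j (partial i f)" "has_partial i (partial j f)"
    and C: "partial j (partial i f) \<in> Cb m" "partial i (partial j f) \<in> Cb m"
    using f by auto
  define h where "h n = inverse (real (Suc n))" for n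
  have h: "0 < h n" for n by (simp add: h_def)
  have h0: "h \<longlonglongrightarrow> 0" unfolding h_def by (rule LIMSEQ_inverse_real_of_nat)
  have "\<exists>a b c d. 0 < a \<and> a < h n \<and> 0 < b \<and> b < h n \<and> 0 < c \<and> c < h n \<and> 0 < d \<and> d < h n \<and>
      partial j (partial i f) (y + a *\<^sub>R axis i 1 + b *\<^sub>R axis j 1)
    = partial i (partial j f) (y + c *\<^sub>R axis j 1 + d *\<^sub>R axis i 1)" for n
  proof -
    obtain a b where ab: "0 < a" "a < h n" "0 < b" "b < h n"
      "f (y + h n *\<^sub>R axis i 1 + h n *\<^sub>R axis j 1) - f (y + h n *\<^sub>R axis i 1) - f (y + h n *\<^sub>R axis j 1) + f y
      = h n * h n * partial j (partial i f) (y + a *\<^sub>R axis i 1 + b *\<^sub>R axis j 1)"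
      using double_difference_mvt[OF P(1,3) h[of n], of y] by blast
    obtain c d where cd: "0 < c" "c < h n" "0 < d" "d < h n"
      "f (y + h n *\<^sub>R axis j 1 + h n *\<^sub>R axis i 1) - f (y + h n *\<^sub>R axis j 1) - f (y + h n *\<^sub>R axis i 1) + f y
      = h n * h n * partial i (partial j f) (y + c *\<^sub>R axis j 1 + d *\<^sub>R axis i 1)"
      using double_difference_mvt[OF P(2,4) h[of n], of y] by blast
    have "h n * h n * partial j (partial i f) (y + a *\<^sub>R axis i 1 + b *\<^sub>R axis j 1)
        = h n * h n * partial i (partial j f) (y + c *\<^sub>R axis j 1 + d *\<^sub>R axis i 1)"
      using ab(5) cd(5) by (simp add: algebra_simps)
    then show ?thesis using ab(1-4) cd(1-4) h[of n]
      by (intro exI[of _ a] exI[of _ b] exI[of _ c] exI[of _ d]) auto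
  qed
  then obtain a b c d where pos: "\<And>n. 0 < a n \<and> a n < h n" "\<And>n. 0 < b n \<and> b n < h n"
      "\<And>n. 0 < c n \<and> c n < h n" "\<And>n. 0 < d n \<and> d n < h n"
    and eq: "\<And>n. partial j (partial i f) (y + a n *\<^sub>R axis i 1 + b n *\<^sub>R axis j 1)
    = partial i (partial j f) (y + c n *\<^sub>R axis j 1 + d n *\<^sub>R axis i 1)"
    by metis
  have lim: "u \<longlonglongrightarrow> 0" if "\<And>n. 0 < u n \<and> u n < h n" for u :: "nat \<Rightarrow> real"
    by (rule tendsto_sandwich[OF _ _ tendsto_const h0]) (auto intro!: always_eventually less_imp_le simp: that)
  have "(\<lambda>n. y + a n *\<^sub>R axis i 1 + b n *\<^sub>R axis j 1) \<longlonglongrightarrow> y + 0 *\<^sub>R axis i 1 + 0 *\<^sub>R axis j 1"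
    by (intro tendsto_intros lim pos)
  then have 1: "(\<lambda>n. partial j (partial i f) (y + a n *\<^sub>R axis i 1 + b n *\<^sub>R axis j 1))
      \<longlonglongrightarrow> partial j (partial i f) y"
    using Cb_imp[OF C(1)] by (intro continuous_on_tendsto_compose[of UNIV "partial j (partial i f)"]) auto
  have "(\<lambda>n. y + c n *\<^sub>R axis j 1 + d n *\<^sub>R axis i 1) \<longlonglongrightarrow> y + 0 *\<^sub>R axis j 1 + 0 *\<^sub>R axis i 1"
    by (intro tendsto_intros lim pos)
  then have 2: "(\<lambda>n. partial i (partial j f) (y + c n *\<^sub>R axis j 1 + d n *\<^sub>R axis i 1))
      \<longlonglongrightarrow> partial i (partial j f) y"
    using Cb_imp[OF C(2)] by (intro continuous_on_tendsto_compose[of UNIV "partial i (partial j f)"]) auto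
  show "partial i (partial j f) y = partial j (partial i f) y"
    by (rule LIMSEQ_unique[OF 2 1[unfolded eq]])
qed

lemma partial_funpow_Cb: "f \<in> Cb (m + n) \<Longrightarrow> (partial i ^^ n) f \<in> Cb m"
proof (induction n arbitrary: m)
  case (Suc n)
  then have "(partial i ^^ n) f \<in> Cb (Suc m)" by (simp del: Cb.simps)
  then show ?case by simp
qed simp

lemma partial_funpow_commute:
  "f \<in> Cb (Suc n) \<Longrightarrow> partial i ((partial j ^^ n) f) = (partial j ^^ n) (partial i f)"
proof (induction n)
  case (Suc n)
  have "(partial j ^^ n) f \<in> Cb (Suc (Suc 0))"
    using Suc.prems by (intro partial_funpow_Cb) (simp del: Cb.simps)
  then have "partial i (partial j ((partial j ^^ n) f)) = partial j (partial i ((partial j ^^ n) f))"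
    by (rule partial_commute)
  moreover have "f \<in> Cb (Suc n)" using Suc.prems Cb_mono by blast
  ultimately show ?case using Suc.IH by simp
qed simp

context
begin

private abbreviation (input) D where "D xs l f \<equiv> foldr (\<lambda>i. partial i ^^ (l $ i)) xs f"

lemma foldr_partial_Cb: "f \<in> Cb (m + (\<Sum>i\<leftarrow>xs. l $ i)) \<Longrightarrow> D xs l f \<in> Cb m"
proof (induction xs arbitrary: m)
  case (Cons x xs)
  then have "D xs l f \<in> Cb (m + l $ x)" by (simp add: add.assoc)
  then show ?case by (simp add: partial_funpow_Cb)
qed simp

lemma foldr_partial_commute:
  "f \<in> Cb (Suc (\<Sum>i\<leftarrow>xs. l $ i)) \<Longrightarrow> partial i (D xs l f) = D xs l (partial i f)"
proof (induction xs)
  case (Cons x xs)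
  have "D xs l f \<in> Cb (Suc (l $ x))"
    using Cons.prems by (intro foldr_partial_Cb) (simp del: Cb.simps)
  then have "partial i (D (x # xs) l f) = (partial x ^^ (l $ x)) (partial i (D xs l f))"
    by (simp add: partial_funpow_commute del: Cb.simps)
  moreover have "f \<in> Cb (Suc (\<Sum>i\<leftarrow>xs. l $ i))"
    using Cons.prems Cb_le[of "Suc (\<Sum>i\<leftarrow>xs. l $ i)" "Suc (\<Sum>i\<leftarrow>x#xs. l $ i)"] by (auto simp del: Cb.simps)
  ultimately show ?case using Cons.IH by simp
qed simp

text \<open>The operators are applied in the fixed order of \<open>xs\<close>, so an additional derivative in direction \<open>i\<close>
first appears in the middle of the product; it reaches \<open>f\<close> because it commutes with all factors to its
right.\<close>

lemma foldr_partial_add_axis: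
  "distinct xs \<Longrightarrow> f \<in> Cb (Suc (\<Sum>i\<leftarrow>xs. l $ i)) \<Longrightarrow>
    D xs (l + axis i 1) f = (if i \<in> set xs then D xs l (partial i f) else D xs l f)"
proof (induction xs)
  case (Cons x xs)
  have f: "f \<in> Cb (Suc (\<Sum>i\<leftarrow>xs. l $ i))"
    using Cons.prems Cb_le[of "Suc (\<Sum>i\<leftarrow>xs. l $ i)" "Suc (\<Sum>i\<leftarrow>x#xs. l $ i)"] by (auto simp del: Cb.simps)
  show ?case
  proof (cases "x = i")
    case True
    then have "D (x # xs) (l + axis i 1) f = (partial i ^^ Suc (l $ i)) (D xs l f)"
      using Cons f by auto
    also have "\<dots> = (partial i ^^ (l $ i)) (partial i (D xs l f))"
      by (simp only: funpow_Suc_right o_apply)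
    finally show ?thesis using True foldr_partial_commute[OF f] by simp
  next
    case False
    then have "(l + axis i 1) $ x = l $ x" by (simp add: axis_def)
    then show ?thesis using Cons f False by auto
  qed
qed simp

end

lemma set_coords [simp]: "set coords = UNIV" and distinct_coords [simp]: "distinct coords"
  by (simp_all add: coords_def)

lemma sum_list_coords: "(\<Sum>i\<leftarrow>coords. l $ i) = mdeg l"
  by (simp add: sum_list_distinct_conv_sum_set mdeg_def)

lemma mpartial_0 [simp]: "mpartial 0 f = f"
proof -
  have "foldr (\<lambda>i. partial i ^^ ((0::'a mindex) $ i)) xs f = f" for xs
    by (induction xs) auto
  then show ?thesis by (simp add: mpartial_def)
qed

lemma mpartial_Cb: "f \<in> Cb (m + mdeg l) \<Longrightarrow> mpartial l f \<in> Cb m"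
  unfolding mpartial_def by (rule foldr_partial_Cb) (simp add: sum_list_coords)

lemma partial_mpartial: "f \<in> Cb (Suc (mdeg l)) \<Longrightarrow> partial i (mpartial l f) = mpartial l (partial i f)"
  unfolding mpartial_def by (rule foldr_partial_commute) (simp add: sum_list_coords del: Cb.simps)

lemma mpartial_add_axis:
  "f \<in> Cb (Suc (mdeg l)) \<Longrightarrow> mpartial (l + axis i 1) f = mpartial l (partial i f)"
  unfolding mpartial_def by (subst foldr_partial_add_axis) (simp_all add: sum_list_coords del: Cb.simps)

lemma mpartial_mpartial:
  "f \<in> Cb (mdeg k + mdeg l) \<Longrightarrow> mpartial l (mpartial k f) = mpartial (k + l) f"
proof (induction l arbitrary: f rule: mindex_induct)
  case (add l i)
  have 1: "mpartial k f \<in> Cb (Suc (mdeg l))"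
    using add.prems by (intro mpartial_Cb) (simp add: add.commute del: Cb.simps)
  have 2: "f \<in> Cb (Suc (mdeg k))" "f \<in> Cb (Suc (mdeg (k + l)))"
    using add.prems Cb_le[of "Suc (mdeg k)" "mdeg k + mdeg (l + axis i 1)"] by (auto simp del: Cb.simps)
  have 3: "partial i f \<in> Cb (mdeg k + mdeg l)" using 2(2) by simp
  show ?case
    using add.IH[OF 3] mpartial_add_axis[OF 1, of i] partial_mpartial[OF 2(1), of i]
      mpartial_add_axis[OF 2(2), of i]
    by (simp add: add.assoc)
qed simp

text \<open>Only those \<open>h\<close> matter that lie between \<open>0\<close> and \<open>c\<close>; the condition \<open>0 \<le> h * c\<close> says so for either sign
of \<open>c\<close>.\<close>

lemma increment_along_axis:
  assumes "has_partial i R" and "\<And>h. \<bar>h\<bar> \<le> \<bar>c\<bar> \<Longrightarrow> 0 \<le> h * c \<Longrightarrow> \<bar>partial i R (z + h *\<^sub>R axis i 1)\<bar> \<le> B"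
  shows "\<bar>R (z + c *\<^sub>R axis i 1) - R z\<bar> \<le> B * \<bar>c\<bar>"
proof -
  have "norm ((\<lambda>h. R (z + h *\<^sub>R axis i 1)) c - (\<lambda>h. R (z + h *\<^sub>R axis i 1)) 0) \<le> B * norm (c - 0)"
  proof (rule field_differentiable_bound)
    show "norm (partial i R (z + h *\<^sub>R axis i 1)) \<le> B" if "h \<in> closed_segment 0 c" for h
      using that assms(2)[of h]
      by (auto simp: closed_segment_eq_real_ivl zero_le_mult_iff split: if_splits)
  qed (auto intro!: has_field_derivative_at_within[OF has_partialD] assms)
  then show ?thesis by simp
qed

text \<open>Passing from \<open>x\<close> to \<open>y\<close> by changing one coordinate after the other stays inside the box spanned by the
two points, and each change is controlled by a single partial derivative.\<close>

lemma increment_bound: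
  fixes R :: "'d::finite point \<Rightarrow> real"
  assumes R: "\<And>i. has_partial i R"
    and B: "\<And>i z. (\<And>j. \<bar>z $ j - x $ j\<bar> \<le> \<bar>y $ j - x $ j\<bar>) \<Longrightarrow> \<bar>partial i R z\<bar> \<le> B"
  shows "\<bar>R y - R x\<bar> \<le> B * (\<Sum>i\<in>UNIV. \<bar>y $ i - x $ i\<bar>)"
proof -
  \<comment> \<open>The path from \<open>x\<close> to \<open>y\<close> after the coordinates in \<open>S\<close> have been changed.\<close>
  define z where "z S = (\<chi> i. if i \<in> S then y $ i else x $ i)" for S
  have "\<bar>R (z S) - R x\<bar> \<le> B * (\<Sum>i\<in>S. \<bar>y $ i - x $ i\<bar>)" if "finite S" for S
    using that
  proof (induction S)
    case empty
    have "z {} = x" by (simp add: z_def vec_eq_iff)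
    then show ?case by simp
  next
    case (insert i S)
    have z: "z (insert i S) = z S + (y $ i - x $ i) *\<^sub>R axis i 1"
      using insert.hyps by (auto simp: z_def vec_eq_iff axis_def)
    have "\<bar>R (z S + (y $ i - x $ i) *\<^sub>R axis i 1) - R (z S)\<bar> \<le> B * \<bar>y $ i - x $ i\<bar>"
      using insert.hyps by (intro increment_along_axis R B) (auto simp: z_def axis_def)
    then have "\<bar>R (z (insert i S)) - R (z S)\<bar> \<le> B * \<bar>y $ i - x $ i\<bar>" unfolding z .
    then show ?case using insert by (simp add: distrib_left)
  qed
  from this[of UNIV] show ?thesis by (simp add: z_def)
qed

definition taylor :: "nat \<Rightarrow> ('d::{finite,linorder} point \<Rightarrow> real) \<Rightarrow> 'd point \<Rightarrow> 'd point \<Rightarrow> real" where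
  "taylor n f x z = (\<Sum>l | mdeg l < n. mpartial l f x * divmon z l)"

lemma taylor_at_0:
  fixes f :: "'d::{finite,linorder} point \<Rightarrow> real"
  assumes "0 < n"
  shows "taylor n f x 0 = f x"
proof -
  have "taylor n f x 0 = (\<Sum>l\<in>{l :: 'd mindex. mdeg l < n}. if l = 0 then f x else 0)"
    unfolding taylor_def by (intro sum.cong) (auto simp: divmon_0_left)
  also have "\<dots> = f x" using assms by (subst sum.delta) auto
  finally show ?thesis .
qed

text \<open>Differentiation in direction \<open>i\<close> kills the monomials without \<open>i\<close> and shifts the others by \<open>axis i 1\<close>;
since the partial derivatives of \<open>f\<close> commute, the result is the Taylor polynomial of \<open>partial i f\<close>, of
one order less.\<close>

lemma taylor_deriv:
  assumes f: "f \<in> Cb (Suc n)"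
  shows "((\<lambda>h. taylor (Suc n) f x (z + h *\<^sub>R axis i 1)) has_field_derivative
     taylor n (partial i f) x (z + h *\<^sub>R axis i 1)) (at h)"
proof -
  let ?P = "{l. mdeg l < Suc n \<and> 0 < l $ i}"
  let ?g = "\<lambda>l h. mpartial l f x * divmon (z + h *\<^sub>R axis i 1) l"
  let ?S = "\<lambda>l. l + axis i 1"
  have P: "?P = ?S ` {l. mdeg l < n}"
  proof -
    have "l \<in> ?S ` {l. mdeg l < n}" if "l \<in> ?P" for l
    proof -
      have l: "l - axis i 1 + axis i 1 = l" using that by (intro mindex_diff_axis) auto
      then have "mdeg l = mdeg (l - axis i 1) + 1" by (metis mdeg_add mdeg_axis(1))
      with l that show ?thesis by (intro image_eqI[of _ _ "l - axis i 1"]) auto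
    qed
    then show ?thesis by auto
  qed
  have "((\<lambda>h. \<Sum>l\<in>{l. mdeg l < n}. ?g (?S l) h) has_field_derivative
      (\<Sum>l\<in>{l. mdeg l < n}. mpartial l (partial i f) x * divmon (z + h *\<^sub>R axis i 1) l)) (at h)"
  proof (intro DERIV_sum)
    fix l :: "'a mindex" assume "l \<in> {l. mdeg l < n}"
    then have "f \<in> Cb (Suc (mdeg l))" using f Cb_le[of "Suc (mdeg l)" "Suc n"] by (auto simp del: Cb.simps)
    then have "mpartial (?S l) f x = mpartial l (partial i f) x" by (simp only: mpartial_add_axis)
    then show "((\<lambda>h. ?g (?S l) h) has_field_derivative
        mpartial l (partial i f) x * divmon (z + h *\<^sub>R axis i 1) l) (at h)"
      by (simp only:) (rule DERIV_cmult[OF divmon_deriv_Suc])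
  qed
  moreover have "(\<Sum>l\<in>{l. mdeg l < n}. ?g (?S l) h) = (\<Sum>l\<in>?P. ?g l h)" for h
    unfolding P by (subst sum.reindex) (auto simp: inj_on_def)
  ultimately have 1: "((\<lambda>h. \<Sum>l\<in>?P. ?g l h) has_field_derivative
      taylor n (partial i f) x (z + h *\<^sub>R axis i 1)) (at h)"
    by (simp add: taylor_def)
  have 2: "((\<lambda>h. \<Sum>l\<in>{l. mdeg l < Suc n} - ?P. ?g l h) has_field_derivative
      (\<Sum>l\<in>{l. mdeg l < Suc n} - ?P. mpartial l f x * 0)) (at h)"
    by (intro DERIV_sum DERIV_cmult divmon_deriv_0) auto
  have "taylor (Suc n) f x (z + h *\<^sub>R axis i 1)
      = (\<Sum>l\<in>{l. mdeg l < Suc n} - ?P. ?g l h) + (\<Sum>l\<in>?P. ?g l h)" for h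
    unfolding taylor_def by (rule sum.subset_diff) auto
  then show ?thesis using DERIV_add[OF 2 1] by simp
qed

text \<open>Induction on the order. By the preceding lemma, the partial derivatives of the remainder of \<open>f\<close> are the
remainders of the partial derivatives of \<open>f\<close>, which are of order \<open>n\<close> by induction. The remainder vanishes
at \<open>x\<close>, so integrating these bounds gains one order. For \<open>n = 0\<close> the claim is the boundedness of \<open>f\<close>.\<close>

lemma taylor_remainder:
  fixes f :: "'d::{finite,linorder} point \<Rightarrow> real"
  assumes "f \<in> Cb n"
  shows "\<exists>C\<ge>0. \<forall>x y. \<bar>f y - taylor n f x (y - x)\<bar> \<le> C * norm (y - x) ^ n"
  using assms
proof (induction n arbitrary: f)
  case 0
  then obtain B where B: "\<And>y. \<bar>f y\<bar> \<le> B" unfolding Cb.simps bounded_iff by auto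
  have "0 \<le> B" using B[of 0] by linarith
  then show ?case using B by (intro exI[of _ B]) (auto simp: taylor_def)
next
  case (Suc n)
  have "\<forall>i. \<exists>C\<ge>0. \<forall>x y. \<bar>partial i f y - taylor n (partial i f) x (y - x)\<bar> \<le> C * norm (y - x) ^ n"
    using Suc by simp
  then obtain C where C: "\<And>i. 0 \<le> C i"
    "\<And>i x y. \<bar>partial i f y - taylor n (partial i f) x (y - x)\<bar> \<le> C i * norm (y - x) ^ n"
    by metis
  define K where "K = (\<Sum>i\<in>UNIV. C i)"
  have K: "C i \<le> K" for i unfolding K_def by (rule member_le_sum) (auto simp: C)
  have K0: "0 \<le> K" unfolding K_def by (rule sum_nonneg) (auto simp: C)
  have "\<bar>f y - taylor (Suc n) f x (y - x)\<bar> \<le> K * real CARD('d) * norm (y - x) ^ Suc n" for x y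
  proof -
    let ?R = "\<lambda>z. f z - taylor (Suc n) f x (z - x)"
    have der: "((\<lambda>h. ?R (z + h *\<^sub>R axis i 1)) has_field_derivative
        partial i f z - taylor n (partial i f) x (z - x)) (at 0)" for i z
    proof -
      have "((\<lambda>h. f (z + h *\<^sub>R axis i 1)) has_field_derivative partial i f z) (at 0)"
        using has_partialD[of i f z 0] Suc.prems by simp
      moreover have "((\<lambda>h. taylor (Suc n) f x (z + h *\<^sub>R axis i 1 - x)) has_field_derivative
          taylor n (partial i f) x (z - x)) (at 0)"
        using taylor_deriv[OF Suc.prems, of x "z - x" i 0] by (simp add: algebra_simps)
      ultimately show ?thesis by (rule DERIV_diff)
    qed
    have "\<bar>?R y - ?R x\<bar> \<le> (K * norm (y - x) ^ n) * (\<Sum>i\<in>UNIV. \<bar>y $ i - x $ i\<bar>)"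
    proof (rule increment_bound)
      show "has_partial i ?R" for i by (rule has_partialI(1)[OF der])
      fix i z assume z: "\<And>j. \<bar>z $ j - x $ j\<bar> \<le> \<bar>y $ j - x $ j\<bar>"
      have "norm (z - x) \<le> norm (y - x)"
        by (rule norm_le_componentwise_cart) (use z in auto)
      then have "C i * norm (z - x) ^ n \<le> K * norm (y - x) ^ n"
        using K K0 C(1) by (intro mult_mono power_mono) auto
      then show "\<bar>partial i ?R z\<bar> \<le> K * norm (y - x) ^ n"
        using C(2)[of i z x] by (simp add: has_partialI(2)[OF der])
    qed
    also have "\<dots> \<le> (K * norm (y - x) ^ n) * (\<Sum>i\<in>(UNIV :: 'd set). norm (y - x))"
      using K0 by (intro mult_left_mono sum_mono)
        (auto simp flip: vector_minus_component intro: component_le_norm_cart)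
    finally show ?thesis
      by (simp add: taylor_at_0 mult.assoc mult.left_commute mult.commute)
  qed
  then show ?case using K0 by (intro exI[of _ "K * real CARD('d)"]) auto
qed

section \<open>Words and their divided powers\<close>

lemma weight_conv_mdeg: "weight w = mdeg (sum_list w)"
  by (induction w) (auto simp: weight_def)

lemma finite_alphabet [simp]: "finite (alphabet \<gamma>)"
  by (rule finite_subset[OF _ finite_mdeg_le[of "Ngam \<gamma>"]]) (auto simp: alphabet_def)

lemma length_le_weight: "w \<in> words \<gamma> \<Longrightarrow> length w \<le> weight w"
proof (induction w)
  case (Cons a w)
  then have "a \<noteq> 0" "w \<in> words \<gamma>" by (auto simp: words_def alphabet_def)
  then have "1 \<le> mdeg a" using mdeg_eq_0_iff[of a] by linarith
  then show ?case using Cons.IH \<open>w \<in> words \<gamma>\<close> by (simp add: weight_def)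
qed simp

lemma finite_words_weight_le [simp]: "finite {w \<in> words \<gamma>. weight w \<le> n}"
proof (rule finite_subset)
  show "{w \<in> words \<gamma>. weight w \<le> n} \<subseteq> {w. set w \<subseteq> alphabet \<gamma> \<and> length w \<le> n}"
    using length_le_weight by (fastforce simp: words_def)
qed (rule finite_lists_length_le[OF finite_alphabet])

lemma words_Nil [simp]: "[] \<in> words \<gamma>"
  and words_append [simp]: "v @ w \<in> words \<gamma> \<longleftrightarrow> v \<in> words \<gamma> \<and> w \<in> words \<gamma>"
  and words_Cons [simp]: "a # w \<in> words \<gamma> \<longleftrightarrow> a \<in> alphabet \<gamma> \<and> w \<in> words \<gamma>"
  by (auto simp: words_def)

definition wcoeff :: "'d::finite word \<Rightarrow> real" where
  "wcoeff w = (\<Prod>a\<leftarrow>w. 1 / real (mfact a))"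

lemma wcoeff_simps [simp]:
  "wcoeff [] = 1" "wcoeff (a # w) = wcoeff w / real (mfact a)" "wcoeff (v @ w) = wcoeff v * wcoeff w"
  by (simp_all add: wcoeff_def)

definition compositions :: "real \<Rightarrow> 'd::finite mindex \<Rightarrow> 'd word set" where
  "compositions \<gamma> l = {w \<in> words \<gamma>. sum_list w = l}"

lemma finite_compositions [simp]: "finite (compositions \<gamma> l)"
  by (rule finite_subset[OF _ finite_words_weight_le[of \<gamma> "mdeg l"]])
    (auto simp: compositions_def weight_conv_mdeg)

lemma compositions_Nil [simp]: "[] \<in> compositions \<gamma> l \<longleftrightarrow> l = 0"
  by (auto simp: compositions_def)

text \<open>This is the divided power
\<open>1 / l! * (e_1 to the power l_1) ... (e_d to the power l_d)\<close> of the letters in the quasi-shuffle algebra,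
written out in words; \<open>qsh_monomial_divpow\<close> below justifies the name. In this normalisation the
coefficients are multiplicative under concatenation, which makes the deconcatenation coproduct of divided
powers transparent.\<close>

definition divpow :: "real \<Rightarrow> 'd::finite mindex \<Rightarrow> 'd word \<Rightarrow>\<^sub>0 real" where
  "divpow \<gamma> l = (\<Sum>w\<in>compositions \<gamma> l. wcoeff w *\<^sub>R word_vec w)"

lemma lookup_sum_word_vec:
  assumes "finite A"
  shows "Poly_Mapping.lookup (\<Sum>v\<in>A. f v *\<^sub>R word_vec v) w = (if w \<in> A then f w else 0)"
proof -
  have "Poly_Mapping.lookup (\<Sum>v\<in>A. f v *\<^sub>R word_vec v) w = (\<Sum>v\<in>A. if w = v then f v else 0)"
    by (simp add: lookup_sum lookup_scaleR lookup_single when_def) (intro sum.cong; auto)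
  then show ?thesis using assms by (simp add: sum.delta')
qed

lemma lookup_divpow:
  "Poly_Mapping.lookup (divpow \<gamma> l) w = (if w \<in> compositions \<gamma> l then wcoeff w else 0)"
  unfolding divpow_def by (rule lookup_sum_word_vec) simp

lemma keys_divpow: "Poly_Mapping.keys (divpow \<gamma> l) \<subseteq> compositions \<gamma> l"
  by (auto simp: in_keys_iff lookup_divpow split: if_splits)

text \<open>The supports of the factors may be enlarged to sets that are easier to sum over.\<close>

lemma qshuffle_supersets:
  assumes "finite K" "Poly_Mapping.keys x \<subseteq> K" "finite L" "Poly_Mapping.keys y \<subseteq> L"
  shows "qshuffle \<gamma> x y = (\<Sum>v\<in>K. \<Sum>w\<in>L.
      (Poly_Mapping.lookup x v * Poly_Mapping.lookup y w) *\<^sub>R qsh_word \<gamma> v w)"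
proof -
  have "(\<Sum>w\<in>Poly_Mapping.keys y. (Poly_Mapping.lookup x v * Poly_Mapping.lookup y w) *\<^sub>R qsh_word \<gamma> v w)
    = (\<Sum>w\<in>L. (Poly_Mapping.lookup x v * Poly_Mapping.lookup y w) *\<^sub>R qsh_word \<gamma> v w)" for v
    using assms by (intro sum.mono_neutral_left) (auto simp: in_keys_iff)
  then show ?thesis unfolding qshuffle_def
    using assms by (simp, intro sum.mono_neutral_left) (auto simp: in_keys_iff)
qed

lemma keys_scaleR_subset: "Poly_Mapping.keys (c *\<^sub>R x) \<subseteq> Poly_Mapping.keys (x :: 'a \<Rightarrow>\<^sub>0 real)"
  by (auto simp: in_keys_iff lookup_scaleR)

lemma qshuffle_scaleR: "qshuffle \<gamma> (a *\<^sub>R x) (b *\<^sub>R y) = (a * b) *\<^sub>R qshuffle \<gamma> x y"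
  by (subst (1 2) qshuffle_supersets[of "Poly_Mapping.keys x" _ "Poly_Mapping.keys y"])
    (simp_all add: keys_scaleR_subset lookup_scaleR scaleR_sum_right mult_ac)

section \<open>Binomial coefficients of multi-indices\<close>

definition mbin :: "'d::finite mindex \<Rightarrow> 'd mindex \<Rightarrow> nat" where
  "mbin m a = (\<Prod>i\<in>UNIV. (m $ i) choose (a $ i))"

lemma mbin_mfact: "mbin (a + b) a * (mfact a * mfact b) = mfact (a + b)"
  by (simp add: mbin_def mfact_def flip: prod.distrib)
    (intro prod.cong refl, metis binomial_fact_lemma add_diff_cancel_left' le_add1 mult.commute mult.left_commute)

lemma finite_splittings [simp]: "finite {(\<alpha>, a'). \<alpha> + a' = (a :: 'd::finite mindex)}"
  by (rule finite_subset[of _ "{\<alpha>. mdeg \<alpha> \<le> mdeg a} \<times> {\<alpha>. mdeg \<alpha> \<le> mdeg a}"]) auto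

lemma mindex_le_imp_add_diff: "(\<And>i. f $ i \<le> a $ i) \<Longrightarrow> f + (a - f) = (a :: 'd::finite mindex)"
  by (simp add: vec_eq_iff)

text \<open>Vandermonde's identity in each coordinate; the sum over all splittings of \<open>a\<close> is the expansion of the
product over the coordinates.\<close>

lemma vandermonde_mbin:
  "(\<Sum>(\<alpha>, a') | \<alpha> + a' = a. mbin g \<alpha> * mbin m a') = mbin (g + m) a"
proof -
  let ?t = "\<lambda>i j. (g $ i choose j) * (m $ i choose (a $ i - j))"
  have "(\<Sum>(\<alpha>, a') | \<alpha> + a' = a. mbin g \<alpha> * mbin m a')
      = (\<Sum>f\<in>PiE UNIV (\<lambda>i. {..a $ i}). \<Prod>i\<in>UNIV. ?t i (f i))"
    by (rule sum.reindex_bij_witness[of _ "\<lambda>f. (vec_lambda f, a - vec_lambda f)" "\<lambda>p. vec_nth (fst p)"])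
      (auto simp: mbin_def prod.distrib intro!: mindex_le_imp_add_diff)
  also have "\<dots> = (\<Prod>i\<in>UNIV. \<Sum>j\<le>a $ i. ?t i j)"
    by (rule prod_sum_PiE[symmetric]) auto
  also have "\<dots> = mbin (g + m) a"
    by (simp add: mbin_def vandermonde)
  finally show ?thesis .
qed

section \<open>Quasi-shuffle products of divided powers\<close>

lemma lookup_append_letter_single:
  "Poly_Mapping.lookup (append_letter x (Poly_Mapping.single a 1)) w =
     (if w \<noteq> [] \<and> last w = a then Poly_Mapping.lookup x (butlast w) else 0)"
proof -
  have eq: "v @ [a] = w \<longleftrightarrow> v = butlast w \<and> w \<noteq> [] \<and> last w = a" for v
    by (cases w rule: rev_cases) auto
  have "Poly_Mapping.lookup (append_letter x (Poly_Mapping.single a 1)) w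
      = (\<Sum>v\<in>Poly_Mapping.keys x. Poly_Mapping.lookup x v * (if v @ [a] = w then 1 else 0))"
    by (simp add: append_letter_def lookup_sum lookup_scaleR lookup_single when_def)
  also have "\<dots> = (\<Sum>v\<in>Poly_Mapping.keys x.
      if v = butlast w then (if w \<noteq> [] \<and> last w = a then Poly_Mapping.lookup x v else 0) else 0)"
    unfolding eq by (rule sum.cong) simp_all
  also have "\<dots> = (if w \<noteq> [] \<and> last w = a then Poly_Mapping.lookup x (butlast w) else 0)"
    by (subst sum.delta) (auto simp: in_keys_iff)
  finally show ?thesis .
qed

lemma append_letter_0_right [simp]: "append_letter x 0 = 0"
  by (simp add: append_letter_def)

lemma lookup_append_letter_bracket:
  "Poly_Mapping.lookup (append_letter x (bracket \<gamma> a b)) w =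
     (if a + b \<in> alphabet \<gamma> \<and> w \<noteq> [] \<and> last w = a + b then Poly_Mapping.lookup x (butlast w) else 0)"
  by (simp add: bracket_def lookup_append_letter_single)

text \<open>In the recursion of the quasi-shuffle product, the last letter of the result comes from the left factor,
from the right factor or from both. Allowing each factor to give up either its last letter or nothing, the
latter recorded as the letter \<open>0\<close>, turns these three cases into one.\<close>

definition strip_last_sum :: "('d::finite word \<Rightarrow> 'd mindex \<Rightarrow> real) \<Rightarrow> 'd word \<Rightarrow> real" where
  "strip_last_sum f p = f p 0 + (if p = [] then 0 else f (butlast p) (last p))"

lemma strip_last_sum_simps: "strip_last_sum f [] = f [] 0" "strip_last_sum f (p @ [a]) = f (p @ [a]) 0 + f p a"
  by (simp_all add: strip_last_sum_def)

lemma lookup_qsh_word_Nil: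
  "Poly_Mapping.lookup (qsh_word \<gamma> p q) [] = (if p = [] \<and> q = [] then 1 else 0)"
  by (cases p rule: rev_cases; cases q rule: rev_cases)
    (simp_all add: qsh_word_rec lookup_add lookup_append_letter_single lookup_append_letter_bracket lookup_single)

text \<open>The condition \<open>\<alpha> + \<beta> = g\<close> covers all three terms of the recursion; \<open>\<alpha> = \<beta> = 0\<close> is excluded because
letters are nonzero.\<close>

lemma lookup_qsh_word_snoc:
  assumes "p \<in> words \<gamma>" "q \<in> words \<gamma>"
  shows "Poly_Mapping.lookup (qsh_word \<gamma> p q) (w @ [g]) = (if g \<in> alphabet \<gamma> then
    strip_last_sum (\<lambda>p' \<alpha>. strip_last_sum (\<lambda>q' \<beta>. if \<alpha> + \<beta> = g then Poly_Mapping.lookup (qsh_word \<gamma> p' q') w else 0) q) p else 0)"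
proof -
  have 0: "g \<noteq> 0" if "g \<in> alphabet \<gamma>" using that by (auto simp: alphabet_def)
  show ?thesis
  proof (cases p rule: rev_cases)
    case Nil
    then show ?thesis using 0 assms
      by (cases q rule: rev_cases) (auto simp: strip_last_sum_simps qsh_word_rec lookup_single when_def)
  next
    case p: (snoc p' \<alpha>)
    show ?thesis
    proof (cases q rule: rev_cases)
      case Nil
      then show ?thesis using 0 assms p by (auto simp: strip_last_sum_simps qsh_word_rec lookup_single when_def)
    next
      case q: (snoc q' \<beta>)
      have "g = \<alpha> \<longleftrightarrow> \<alpha> = g" "g = \<beta> \<longleftrightarrow> \<beta> = g" "g = \<alpha> + \<beta> \<longleftrightarrow> \<alpha> + \<beta> = g" by auto
      moreover have "\<alpha> \<in> alphabet \<gamma>" "\<beta> \<in> alphabet \<gamma>" using assms p q by auto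
      ultimately show ?thesis unfolding p q using 0
        by (simp add: strip_last_sum_simps qsh_word_rec lookup_add lookup_append_letter_single
            lookup_append_letter_bracket) blast
    qed
  qed
qed

text \<open>The possible first components are the letters that a composition of \<open>a\<close> can end in, together with \<open>0\<close>
for leaving the word as it is.\<close>

definition splits :: "real \<Rightarrow> 'd::finite mindex \<Rightarrow> ('d mindex \<times> 'd mindex) set" where
  "splits \<gamma> a = {(\<alpha>, a'). \<alpha> + a' = a \<and> (\<alpha> = 0 \<or> \<alpha> \<in> alphabet \<gamma>)}"

lemma finite_splits [simp]: "finite (splits \<gamma> a)"
  by (rule finite_subset[OF _ finite_splittings[of a]]) (auto simp: splits_def)

lemma sum_compositions_strip_last_sum:
  "(\<Sum>p\<in>compositions \<gamma> a. wcoeff p * strip_last_sum f p) =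
   (\<Sum>(\<alpha>, a')\<in>splits \<gamma> a. \<Sum>p\<in>compositions \<gamma> a'. wcoeff p / real (mfact \<alpha>) * f p \<alpha>)"
proof -
  let ?A = "{(\<alpha>, a'). \<alpha> + a' = a \<and> \<alpha> \<in> alphabet \<gamma>}"
  let ?h = "\<lambda>\<alpha> p. wcoeff p / real (mfact \<alpha>) * f p \<alpha>"
  have fA: "finite ?A" by (rule finite_subset[OF _ finite_splits[of \<gamma> a]]) (auto simp: splits_def)
  have 0: "(0, a) \<notin> ?A" by (simp add: alphabet_def)
  have s: "splits \<gamma> a = insert (0, a) ?A" by (auto simp: splits_def)
  have "(\<Sum>p\<in>compositions \<gamma> a. wcoeff p * strip_last_sum f p) =
     (\<Sum>p\<in>compositions \<gamma> a. wcoeff p * f p 0) +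
     (\<Sum>p\<in>compositions \<gamma> a. wcoeff p * (if p = [] then 0 else f (butlast p) (last p)))"
    by (simp add: strip_last_sum_def distrib_left sum.distrib)
  also have "(\<Sum>p\<in>compositions \<gamma> a. wcoeff p * (if p = [] then 0 else f (butlast p) (last p)))
     = (\<Sum>p\<in>compositions \<gamma> a - {[]}. wcoeff p * f (butlast p) (last p))"
    by (intro sum.mono_neutral_cong_right) auto
  also have "\<dots> = (\<Sum>(x, p)\<in>Sigma ?A (\<lambda>x. compositions \<gamma> (snd x)). ?h (fst x) p)"
  proof (rule sum.reindex_bij_witness[of _ "\<lambda>(x, p). p @ [fst x]"
          "\<lambda>p. ((last p, sum_list (butlast p)), butlast p)"], goal_cases)
    case (2 p)
    then show ?case by (cases p rule: rev_cases) (auto simp: compositions_def add.commute)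
  next
    case (5 p)
    then show ?case by (cases p rule: rev_cases) auto
  qed (auto simp: compositions_def add.commute)
  also have "\<dots> = (\<Sum>(\<alpha>, a')\<in>?A. \<Sum>p\<in>compositions \<gamma> a'. ?h \<alpha> p)"
    by (subst sum.Sigma[symmetric]) (auto simp: fA split_beta)
  finally show ?thesis unfolding s using fA 0 by simp
qed

text \<open>Multiplied by \<open>g!\<close>, this is Vandermonde's identity for \<open>g + m\<close>: the pair \<open>(\<alpha>, a')\<close> determines
\<open>\<beta> = g - \<alpha>\<close> and \<open>b' = m - a'\<close>. When these differences do not exist, the product of binomial coefficients
is zero.\<close>

lemma split_identity:
  assumes g: "g \<in> alphabet \<gamma>" and gm: "g + m = a + b"
  shows "(\<Sum>x\<in>splits \<gamma> a. \<Sum>y\<in>splits \<gamma> b. if fst x + fst y = g then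
      real (mbin (snd x + snd y) (snd x)) / (real (mfact (fst x)) * real (mfact (fst y))) else 0)
    = real (mbin (a + b) a) / real (mfact g)"
proof -
  have sub: "\<alpha> = 0 \<or> \<alpha> \<in> alphabet \<gamma>" if "\<alpha> + \<beta> = g" for \<alpha> \<beta>
    using g that by (auto simp: alphabet_def)
  have inner: "(\<Sum>y\<in>splits \<gamma> b. if \<alpha> + fst y = g then
      real (mbin (a' + snd y) a') / (real (mfact \<alpha>) * real (mfact (fst y))) else 0)
     = real (mbin g \<alpha> * mbin m a') / real (mfact g)" if aa: "\<alpha> + a' = a" for \<alpha> a'
  proof (cases "\<exists>\<beta> b'. \<alpha> + \<beta> = g \<and> \<beta> + b' = b")
    case True
    then obtain \<beta> b' where *: "\<alpha> + \<beta> = g" "\<beta> + b' = b" by blast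
    then have y: "(\<beta>, b') \<in> splits \<gamma> b" using sub[of \<beta> \<alpha>] by (auto simp: splits_def add.commute)
    have eq: "\<alpha> + fst y = g \<longleftrightarrow> y = (\<beta>, b')" if "y \<in> splits \<gamma> b" for y
      using that * by (auto simp: splits_def)
    have "g + m = (\<alpha> + a') + (\<beta> + b')" by (simp only: gm aa *)
    also have "\<dots> = (\<alpha> + \<beta>) + (a' + b')" by (simp only: ac_simps)
    finally have "g + m = g + (a' + b')" by (simp only: *)
    then have m: "m = a' + b'" by (rule add_left_imp_eq)
    have "real (mbin g \<alpha>) * (real (mfact \<alpha>) * real (mfact \<beta>)) = real (mfact g)"
      using mbin_mfact[of \<alpha> \<beta>] * by (metis of_nat_mult)
    then have fr: "1 / (real (mfact \<alpha>) * real (mfact \<beta>)) = real (mbin g \<alpha>) / real (mfact g)"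
      by (auto simp: divide_simps)
    have "(\<Sum>y\<in>splits \<gamma> b. if \<alpha> + fst y = g then
        real (mbin (a' + snd y) a') / (real (mfact \<alpha>) * real (mfact (fst y))) else 0)
      = (\<Sum>y\<in>splits \<gamma> b. if y = (\<beta>, b') then
        real (mbin (a' + snd y) a') / (real (mfact \<alpha>) * real (mfact (fst y))) else 0)"
      by (intro sum.cong) (auto simp: eq)
    also have "\<dots> = real (mbin m a') * (1 / (real (mfact \<alpha>) * real (mfact \<beta>)))"
      using y by (subst sum.delta) (auto simp: m)
    finally show ?thesis unfolding fr by simp
  next
    case False
    have "mbin g \<alpha> * mbin m a' = 0"
    proof (cases "\<forall>i. \<alpha> $ i \<le> g $ i")
      case True
      then have ag: "\<alpha> + (g - \<alpha>) = g" by (simp add: mindex_le_imp_add_diff)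
      have "\<not> (\<forall>i. (g - \<alpha>) $ i \<le> b $ i)"
        using False ag mindex_le_imp_add_diff[of "g - \<alpha>" b] by blast
      then obtain i where i: "b $ i < (g - \<alpha>) $ i" by (auto simp: not_le)
      have "g $ i + m $ i = a $ i + b $ i" using gm by (metis vector_add_component)
      moreover have "\<alpha> $ i + a' $ i = a $ i" using aa by (metis vector_add_component)
      moreover have "\<alpha> $ i \<le> g $ i" using True by blast
      ultimately have "m $ i < a' $ i" using i by simp
      then have "mbin m a' = 0" by (auto simp: mbin_def)
      then show ?thesis by simp
    next
      case False
      then have "mbin g \<alpha> = 0" by (auto simp: mbin_def not_le)
      then show ?thesis by simp
    qed
    moreover have "\<alpha> + fst y \<noteq> g" if "y \<in> splits \<gamma> b" for y
      using False that by (auto simp: splits_def)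
    ultimately show ?thesis by simp
  qed
  have "(\<Sum>x\<in>splits \<gamma> a. \<Sum>y\<in>splits \<gamma> b. if fst x + fst y = g then
      real (mbin (snd x + snd y) (snd x)) / (real (mfact (fst x)) * real (mfact (fst y))) else 0)
     = (\<Sum>x\<in>splits \<gamma> a. real (mbin g (fst x) * mbin m (snd x)) / real (mfact g))"
    by (intro sum.cong refl inner) (auto simp: splits_def)
  also have "\<dots> = (\<Sum>x\<in>{(\<alpha>, a'). \<alpha> + a' = a}. real (mbin g (fst x) * mbin m (snd x)) / real (mfact g))"
  proof (intro sum.mono_neutral_left ballI)
    fix x assume x: "x \<in> {(\<alpha>, a'). \<alpha> + a' = a} - splits \<gamma> a"
    have "mbin g (fst x) = 0"
    proof (rule ccontr)
      assume "mbin g (fst x) \<noteq> 0"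
      then have "\<forall>i. fst x $ i \<le> g $ i" by (simp add: mbin_def not_less)
      then have "fst x = 0 \<or> fst x \<in> alphabet \<gamma>"
        by (intro sub[of _ "g - fst x"]) (simp add: mindex_le_imp_add_diff)
      with x show False by (auto simp: splits_def)
    qed
    then show "real (mbin g (fst x) * mbin m (snd x)) / real (mfact g) = 0" by simp
  qed (auto simp: splits_def)
  also have "\<dots> = real (\<Sum>(\<alpha>, a') | \<alpha> + a' = a. mbin g \<alpha> * mbin m a') / real (mfact g)"
    by (simp add: sum_divide_distrib split_beta)
  finally show ?thesis unfolding vandermonde_mbin gm .
qed

text \<open>Induction on the word from its last letter. Stripping the last letter \<open>g\<close> distributes it over the two
factors in all ways \<open>g = \<alpha> + \<beta>\<close>; the induction hypothesis evaluates what is left, and the binomial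
coefficients add up by \<open>split_identity\<close>.\<close>

lemma lookup_qshuffle_divpow:
  "(\<Sum>p\<in>compositions \<gamma> a. \<Sum>q\<in>compositions \<gamma> b. wcoeff p * wcoeff q * Poly_Mapping.lookup (qsh_word \<gamma> p q) w)
     = (if w \<in> compositions \<gamma> (a + b) then real (mbin (a + b) a) * wcoeff w else 0)" (is "?F a b w = _")
proof (induction w arbitrary: a b rule: rev_induct)
  case Nil
  have "?F a b [] = (\<Sum>p\<in>compositions \<gamma> a. \<Sum>q\<in>compositions \<gamma> b. if q = [] then if p = [] then 1 else 0 else 0)"
    by (intro sum.cong) (auto simp: lookup_qsh_word_Nil)
  also have "\<dots> = (if a = 0 \<and> b = 0 then 1 else 0)"
    by (cases "b = 0") simp_all
  also have "(a = 0 \<and> b = 0) = (a + b = 0)"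
    by (auto simp flip: mdeg_eq_0_iff)
  finally show ?case
    using \<open>(a = 0 \<and> b = 0) = (a + b = 0)\<close> by (auto simp: mbin_def)
next
  case (snoc g w)
  show ?case
  proof (cases "g \<in> alphabet \<gamma>")
    case False
    then have "?F a b (w @ [g]) = 0"
      by (intro sum.neutral ballI) (auto simp: lookup_qsh_word_snoc compositions_def)
    then show ?thesis using False by (simp add: compositions_def)
  next
    case g: True
    let ?L = "\<lambda>p \<alpha> q \<beta>. if \<alpha> + \<beta> = g then Poly_Mapping.lookup (qsh_word \<gamma> p q) w else 0"
    have "?F a b (w @ [g]) = (\<Sum>p\<in>compositions \<gamma> a. wcoeff p *
        strip_last_sum (\<lambda>p' \<alpha>. \<Sum>q\<in>compositions \<gamma> b. wcoeff q * strip_last_sum (?L p' \<alpha>) q) p)"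
    proof (intro sum.cong refl)
      fix p assume p: "p \<in> compositions \<gamma> a"
      have "(\<Sum>q\<in>compositions \<gamma> b. wcoeff p * wcoeff q * Poly_Mapping.lookup (qsh_word \<gamma> p q) (w @ [g]))
        = (\<Sum>q\<in>compositions \<gamma> b. wcoeff p * wcoeff q * strip_last_sum (\<lambda>p' \<alpha>. strip_last_sum (?L p' \<alpha>) q) p)"
        using p g by (intro sum.cong) (auto simp: lookup_qsh_word_snoc compositions_def)
      also have "\<dots> = wcoeff p * strip_last_sum (\<lambda>p' \<alpha>. \<Sum>q\<in>compositions \<gamma> b. wcoeff q * strip_last_sum (?L p' \<alpha>) q) p"
        unfolding strip_last_sum_def[of _ p]
        by (cases "p = []") (simp_all add: sum_distrib_left distrib_left sum.distrib mult.assoc)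
      finally show "(\<Sum>q\<in>compositions \<gamma> b. wcoeff p * wcoeff q * Poly_Mapping.lookup (qsh_word \<gamma> p q) (w @ [g]))
        = wcoeff p * strip_last_sum (\<lambda>p' \<alpha>. \<Sum>q\<in>compositions \<gamma> b. wcoeff q * strip_last_sum (?L p' \<alpha>) q) p" .
    qed
    also have "\<dots> = (\<Sum>(\<alpha>, a')\<in>splits \<gamma> a. \<Sum>p\<in>compositions \<gamma> a'. wcoeff p / real (mfact \<alpha>) *
        (\<Sum>(\<beta>, b')\<in>splits \<gamma> b. \<Sum>q\<in>compositions \<gamma> b'. wcoeff q / real (mfact \<beta>) * ?L p \<alpha> q \<beta>))"
      unfolding sum_compositions_strip_last_sum ..
    also have "\<dots> = (\<Sum>(\<alpha>, a')\<in>splits \<gamma> a. \<Sum>(\<beta>, b')\<in>splits \<gamma> b. \<Sum>p\<in>compositions \<gamma> a'. \<Sum>q\<in>compositions \<gamma> b'.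
        (wcoeff p / real (mfact \<alpha>)) * (wcoeff q / real (mfact \<beta>) * ?L p \<alpha> q \<beta>))"
      by (simp add: sum_distrib_left split_beta) (intro sum.cong refl sum.swap)
    also have "\<dots> = (\<Sum>x\<in>splits \<gamma> a. \<Sum>y\<in>splits \<gamma> b. if fst x + fst y = g then
        ?F (snd x) (snd y) w / (real (mfact (fst x)) * real (mfact (fst y))) else 0)"
      by (auto simp: split_beta sum_divide_distrib intro!: sum.cong)
    also have "\<dots> = (\<Sum>x\<in>splits \<gamma> a. \<Sum>y\<in>splits \<gamma> b. (if fst x + fst y = g then
        real (mbin (snd x + snd y) (snd x)) / (real (mfact (fst x)) * real (mfact (fst y))) else 0) *
        (if w @ [g] \<in> compositions \<gamma> (a + b) then wcoeff w else 0))"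
    proof (intro sum.cong refl)
      fix x y assume xy: "x \<in> splits \<gamma> a" "y \<in> splits \<gamma> b"
      have "w \<in> compositions \<gamma> (snd x + snd y) \<longleftrightarrow> w @ [g] \<in> compositions \<gamma> (a + b)" if "fst x + fst y = g"
      proof -
        have "a + b = (snd x + snd y) + g"
          using xy that by (auto simp: splits_def ac_simps)
        then show ?thesis using g by (auto simp: compositions_def)
      qed
      then show "(if fst x + fst y = g then
        ?F (snd x) (snd y) w / (real (mfact (fst x)) * real (mfact (fst y))) else 0) =
        (if fst x + fst y = g then
        real (mbin (snd x + snd y) (snd x)) / (real (mfact (fst x)) * real (mfact (fst y))) else 0) *
        (if w @ [g] \<in> compositions \<gamma> (a + b) then wcoeff w else 0)"
        unfolding snoc.IH by auto
    qed
    also have "\<dots> = (\<Sum>x\<in>splits \<gamma> a. \<Sum>y\<in>splits \<gamma> b. (if fst x + fst y = g then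
        real (mbin (snd x + snd y) (snd x)) / (real (mfact (fst x)) * real (mfact (fst y))) else 0)) *
        (if w @ [g] \<in> compositions \<gamma> (a + b) then wcoeff w else 0)"
      by (simp only: sum_distrib_right)
    also have "\<dots> = (if w @ [g] \<in> compositions \<gamma> (a + b) then real (mbin (a + b) a) * wcoeff (w @ [g]) else 0)"
    proof (cases "w @ [g] \<in> compositions \<gamma> (a + b)")
      case True
      then have "g + sum_list w = a + b" by (simp add: compositions_def add.commute)
      from split_identity[OF g this] True show ?thesis by simp
    qed simp
    finally show ?thesis .
  qed
qed

text \<open>The structure constants are binomial coefficients, as for divided powers in a commutative polynomial
ring.\<close>

lemma qshuffle_divpow:
  "qshuffle \<gamma> (divpow \<gamma> a) (divpow \<gamma> b) = real (mbin (a + b) a) *\<^sub>R divpow \<gamma> (a + b)"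
proof (rule poly_mapping_eqI)
  fix w
  have "Poly_Mapping.lookup (qshuffle \<gamma> (divpow \<gamma> a) (divpow \<gamma> b)) w =
    (\<Sum>p\<in>compositions \<gamma> a. \<Sum>q\<in>compositions \<gamma> b. wcoeff p * wcoeff q * Poly_Mapping.lookup (qsh_word \<gamma> p q) w)"
    by (subst qshuffle_supersets[of "compositions \<gamma> a" _ "compositions \<gamma> b"])
      (auto simp: keys_divpow lookup_sum lookup_scaleR lookup_divpow intro!: sum.cong)
  then show "Poly_Mapping.lookup (qshuffle \<gamma> (divpow \<gamma> a) (divpow \<gamma> b)) w
      = Poly_Mapping.lookup (real (mbin (a + b) a) *\<^sub>R divpow \<gamma> (a + b)) w"
    by (simp add: lookup_qshuffle_divpow lookup_scaleR lookup_divpow)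
qed

lemma divpow_0: "divpow \<gamma> 0 = word_vec []"
proof -
  have "w = []" if "w \<in> compositions \<gamma> 0" for w
  proof -
    have "length w \<le> mdeg (sum_list w)"
      using that length_le_weight[of w \<gamma>] by (simp add: compositions_def weight_conv_mdeg)
    then show ?thesis using that by (simp add: compositions_def)
  qed
  then have "compositions \<gamma> (0 :: 'a mindex) = {[]}" by (auto simp: compositions_def)
  then show ?thesis by (simp add: divpow_def)
qed

lemma divpow_axis:
  fixes i :: "'d::finite"
  assumes "1 \<le> Ngam \<gamma>"
  shows "divpow \<gamma> (axis i 1) = word_vec [axis i 1]"
proof -
  have nz: "axis i 1 \<noteq> (0 :: 'd mindex)"
    by (metis mdeg_axis(1) mdeg_0 zero_neq_one)
  have "w = [axis i 1]" if "w \<in> compositions \<gamma> (axis i 1)" for w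
  proof -
    have "length w \<le> mdeg (sum_list w)"
      using that length_le_weight[of w \<gamma>] by (simp add: compositions_def weight_conv_mdeg)
    then have "length w \<le> 1" using that by (simp add: compositions_def)
    then show ?thesis using that nz by (cases w) (auto simp: compositions_def)
  qed
  moreover have "[axis i 1] \<in> compositions \<gamma> (axis i 1)"
    using assms nz by (auto simp: compositions_def alphabet_def)
  ultimately have "compositions \<gamma> (axis i 1) = {[axis i 1]}" by blast
  then show ?thesis by (simp add: divpow_def)
qed

lemma qsh_power_axis:
  fixes i :: "'d::finite"
  assumes "1 \<le> Ngam \<gamma>"
  shows "qsh_power \<gamma> (word_vec [axis i 1]) n = fact n *\<^sub>R divpow \<gamma> (axis i n)"
proof (induction n)
  case 0
  have "axis i 0 = (0 :: 'd mindex)" by (simp add: vec_eq_iff axis_def)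
  note axis0 = this
  show ?case by (simp add: axis0 divpow_0)
next
  case (Suc n)
  have ax: "axis i 1 + axis i n = (axis i (Suc n) :: 'd mindex)"
    by (simp add: vec_eq_iff axis_def)
  have "mbin (axis i (Suc n)) (axis i 1 :: 'd mindex) = (\<Prod>j\<in>UNIV. if j = i then Suc n else 1)"
    unfolding mbin_def by (intro prod.cong) (auto simp: axis_def)
  then have mb: "mbin (axis i (Suc n)) (axis i 1 :: 'd mindex) = Suc n" by simp
  have "qsh_power \<gamma> (word_vec [axis i 1]) (Suc n)
      = qshuffle \<gamma> (1 *\<^sub>R divpow \<gamma> (axis i 1)) (fact n *\<^sub>R divpow \<gamma> (axis i n))"
    using Suc assms by (simp add: divpow_axis[unfolded One_nat_def])
  also have "\<dots> = fact (Suc n) *\<^sub>R divpow \<gamma> (axis i (Suc n))"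
    unfolding qshuffle_scaleR qshuffle_divpow ax mb by simp
  finally show ?case .
qed

text \<open>The partial products, over a list of coordinates, that occur in the definition of \<open>qsh_monomial\<close>.\<close>

abbreviation axis_factors :: "real \<Rightarrow> 'd::finite mindex \<Rightarrow> 'd list \<Rightarrow> 'd word \<Rightarrow>\<^sub>0 real" where
  "axis_factors \<gamma> l xs \<equiv>
     foldr (\<lambda>i. qshuffle \<gamma> (qsh_power \<gamma> (word_vec [axis i 1]) (l $ i))) xs (word_vec [])"

text \<open>The coordinates in the list are distinct, so the multi-indices that are multiplied have disjoint supports
and the binomial coefficient is \<open>1\<close>.\<close>

lemma axis_factors_divpow:
  assumes "1 \<le> Ngam \<gamma>" "distinct xs"
  shows "axis_factors \<gamma> l xs
    = (\<Prod>i\<in>set xs. fact (l $ i)) *\<^sub>R divpow \<gamma> (\<chi> i. if i \<in> set xs then l $ i else 0)"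
  using assms(2)
proof (induction xs)
  case Nil
  have "(\<chi> i. 0) = (0 :: 'a mindex)" by (simp add: vec_eq_iff)
  then show ?case by (simp add: divpow_0)
next
  case (Cons x xs)
  let ?r = "\<lambda>S. \<chi> i. if i \<in> S then l $ i else 0"
  have ax: "axis x (l $ x) + ?r (set xs) = ?r (set (x # xs))"
    using Cons.prems by (auto simp: vec_eq_iff axis_def)
  have mb: "mbin (?r (set (x # xs))) (axis x (l $ x)) = 1"
    unfolding mbin_def by (rule prod.neutral) (auto simp: axis_def)
  have "axis_factors \<gamma> l (x # xs)
    = qshuffle \<gamma> (fact (l $ x) *\<^sub>R divpow \<gamma> (axis x (l $ x)))
        ((\<Prod>i\<in>set xs. fact (l $ i)) *\<^sub>R divpow \<gamma> (?r (set xs)))"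
    using Cons assms by (simp add: qsh_power_axis[unfolded One_nat_def])
  also have "\<dots> = (\<Prod>i\<in>set (x # xs). fact (l $ i)) *\<^sub>R divpow \<gamma> (?r (set (x # xs)))"
    unfolding qshuffle_scaleR qshuffle_divpow ax mb using Cons.prems by simp
  finally show ?case .
qed

lemma qsh_monomial_divpow:
  assumes "1 \<le> Ngam \<gamma>"
  shows "qsh_monomial \<gamma> l = real (mfact l) *\<^sub>R divpow \<gamma> l"
  unfolding qsh_monomial_def using axis_factors_divpow[OF assms, of coords l]
  by (simp add: mfact_def vec_lambda_eta)

section \<open>Sums over partitions and the sewing lemma\<close>

fun psum :: "(real \<Rightarrow> real \<Rightarrow> real) \<Rightarrow> real list \<Rightarrow> real" where
  "psum \<Xi> (u # v # ts) = \<Xi> u v + psum \<Xi> (v # ts)"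
| "psum \<Xi> _ = 0"

lemma psum_conv_nth: "psum \<Xi> ts = (\<Sum>j < length ts - 1. \<Xi> (ts ! j) (ts ! Suc j))"
  by (induction \<Xi> ts rule: psum.induct) (simp_all add: sum.lessThan_Suc_shift del: sum.lessThan_Suc)

lemma psum_append:
  "xs \<noteq> [] \<Longrightarrow> ys \<noteq> [] \<Longrightarrow> psum \<Xi> (xs @ ys) = psum \<Xi> xs + \<Xi> (last xs) (hd ys) + psum \<Xi> ys"
  by (induction \<Xi> xs rule: psum.induct; cases ys) auto

lemma psum_append_overlap: "psum \<Xi> (xs @ v # ys) = psum \<Xi> (xs @ [v]) + psum \<Xi> (v # ys)"
  using psum_append[of xs "v # ys" \<Xi>] psum_append[of xs "[v]" \<Xi>] by (cases "xs = []") simp_all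

lemma psum_diff: "psum (\<lambda>u v. f u v - g u v) ts = psum f ts - psum g ts"
  by (simp add: psum_conv_nth sum_subtractf)

lemma psum_sum: "psum (\<lambda>u v. \<Sum>k\<in>A. f k u v) ts = (\<Sum>k\<in>A. psum (f k) ts)"
  by (simp add: psum_conv_nth sum.swap[of _ A])

lemma psum_cmult: "psum (\<lambda>u v. c * f u v) ts = c * psum f ts"
  by (simp add: psum_conv_nth sum_distrib_left)

lemma psum_telescope: "ts \<noteq> [] \<Longrightarrow> psum (\<lambda>u v. g v - g u) ts = g (last ts) - g (hd ts)"
  by (induction "\<lambda>u v. g v - g u" ts rule: psum.induct) auto

lemma sorted_wrt_hd_le: "sorted_wrt (<) (ts :: real list) \<Longrightarrow> x \<in> set ts \<Longrightarrow> hd ts \<le> x"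
  by (cases ts) auto

lemma sorted_wrt_le_last: "sorted_wrt (<) (ts :: real list) \<Longrightarrow> x \<in> set ts \<Longrightarrow> x \<le> last ts"
  by (induction ts) (auto simp: less_imp_le)

lemma psum_mono:
  assumes "sorted_wrt (<) ts" "set ts \<subseteq> A" "\<And>u v. u \<in> A \<Longrightarrow> v \<in> A \<Longrightarrow> u < v \<Longrightarrow> \<bar>f u v\<bar> \<le> g u v"
  shows "\<bar>psum f ts\<bar> \<le> psum g ts"
  using assms
proof (induction f ts rule: psum.induct)
  case (1 f u v ts)
  then have "\<bar>f u v\<bar> \<le> g u v" "\<bar>psum f (v # ts)\<bar> \<le> psum g (v # ts)" by auto
  then show ?case by simp
qed auto

lemma psum_powr_le_mesh:
  assumes "sorted_wrt (<) ts" "successively (\<lambda>u v. v - u < \<delta>) ts" "1 < \<theta>" "0 < \<delta>" "ts \<noteq> []"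
  shows "psum (\<lambda>u v. (v - u) powr \<theta>) ts \<le> \<delta> powr (\<theta> - 1) * (last ts - hd ts)"
  using assms
proof (induction "\<lambda>u v. (v - u) powr \<theta>" ts rule: psum.induct)
  case (1 u v ts)
  then have uv: "0 < v - u" "v - u < \<delta>" by auto
  have "(v - u) powr \<theta> = (v - u) powr (\<theta> - 1) * (v - u)"
    using uv powr_add[of "v - u" "\<theta> - 1" 1] by simp
  also have "\<dots> \<le> \<delta> powr (\<theta> - 1) * (v - u)"
    using uv \<open>1 < \<theta>\<close> by (intro mult_right_mono powr_mono2) auto
  finally show ?case using 1 by (simp add: algebra_simps)
qed auto

text \<open>The value is the fixed point of \<open>K \<mapsto> 2 powr (1 - \<theta>) * K + 2 * C\<close>, the recursion for the error when a
partition is cut near the midpoint of its range.\<close>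

definition sewing_constant :: "real \<Rightarrow> real \<Rightarrow> real" where
  "sewing_constant C \<theta> = 2 * C / (1 - 2 powr (1 - \<theta>))"

context
  fixes \<Xi> :: "real \<Rightarrow> real \<Rightarrow> real" and T C \<theta> :: real
  assumes theta: "1 < \<theta>" and C: "0 \<le> C"
    and almost_additive: "\<And>s u t. 0 \<le> s \<Longrightarrow> s \<le> u \<Longrightarrow> u \<le> t \<Longrightarrow> t \<le> T \<Longrightarrow>
      \<bar>\<Xi> s t - \<Xi> s u - \<Xi> u t\<bar> \<le> C * (t - s) powr \<theta>"
begin

private abbreviation (input) K where "K \<equiv> sewing_constant C \<theta>"

lemma sewing_constant_fixpoint: "0 \<le> K" "2 * K * (1 / 2) powr \<theta> + 2 * C = K"
proof -
  have "2 powr (1 - \<theta>) < 2 powr 0" using theta by (intro powr_less_mono) auto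
  then have lt: "2 powr (1 - \<theta>) < 1" by simp
  then show "0 \<le> K" using C by (simp add: sewing_constant_def)
  have "2 * (1 / 2) powr \<theta> = 2 powr (1 - \<theta>)" by (simp add: powr_diff powr_divide)
  then have "2 * K * (1 / 2) powr \<theta> = K * 2 powr (1 - \<theta>)" by (simp add: mult.assoc)
  moreover have "K * (1 - 2 powr (1 - \<theta>)) = 2 * C" using lt theta by (simp add: sewing_constant_def)
  then have "K - K * 2 powr (1 - \<theta>) = 2 * C" by (simp only: right_diff_distrib mult_1_right)
  ultimately show "2 * K * (1 / 2) powr \<theta> + 2 * C = K" by linarith
qed

text \<open>Induction on the number of points. Let \<open>[u, v]\<close> be the interval of the partition that contains the
midpoint of \<open>[a, b]\<close>. The parts to the left of \<open>u\<close> and to the right of \<open>v\<close> have length at most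
\<open>(b - a) / 2\<close>, so together they contribute a factor \<open>2 powr (1 - \<theta>) < 1\<close>, and inserting \<open>u\<close> and \<open>v\<close> into
\<open>[a, b]\<close> costs two applications of the hypothesis. The sewing constant absorbs the sum.\<close>

lemma sewing_bound:
  assumes "ts \<noteq> []" "sorted_wrt (<) ts" "set ts \<subseteq> {0..T}"
  shows "\<bar>psum \<Xi> ts - \<Xi> (hd ts) (last ts)\<bar> \<le> K * (last ts - hd ts) powr \<theta>"
  using assms
proof (induction ts rule: length_induct)
  case (1 ts)
  let ?a = "hd ts" and ?b = "last ts"
  have ab: "?a \<in> set ts" "?b \<in> set ts" using 1 by auto
  show ?case
  proof (cases "?a < ?b")
    case False
    then have eq: "?a = ?b" using 1 ab sorted_wrt_hd_le[of ts ?b] by auto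
    have "ts = [?a]"
      using 1 eq by (cases ts) (auto split: if_splits dest: sorted_wrt_le_last)
    moreover have "?a \<in> {0..T}" using 1 ab by blast
    then have "\<Xi> ?a ?a = 0" using almost_additive[of ?a ?a ?a] by simp
    ultimately have "psum \<Xi> ts = 0" "\<Xi> ?a ?b = 0" using eq by (metis psum.simps(3), simp)
    then show ?thesis using sewing_constant_fixpoint(1) by simp
  next
    case True
    \<comment> \<open>The last point up to the midpoint and the first one after it.\<close>
    define m where "m = (?a + ?b) / 2"
    define xs where "xs = takeWhile (\<lambda>x. x \<le> m) ts"
    define ys where "ys = dropWhile (\<lambda>x. x \<le> m) ts"
    have ts: "ts = xs @ ys" by (simp add: xs_def ys_def)
    have m: "?a \<le> m" "m < ?b" using True by (auto simp: m_def)
    have xs: "xs \<noteq> []" using 1 m by (cases ts) (auto simp: xs_def)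
    have ys: "ys \<noteq> []" using ab m by (auto simp: ys_def dropWhile_eq_Nil_conv not_le)
    define u v where "u = last xs" and "v = hd ys"
    have um: "u \<le> m" using xs set_takeWhileD[of u "\<lambda>x. x \<le> m" ts] by (auto simp: u_def xs_def)
    have mv: "m < v" using hd_dropWhile[of "\<lambda>x. x \<le> m" ts] ys by (simp add: v_def ys_def)
    have hl: "hd xs = ?a" "last ys = ?b" using xs ys ts by auto
    have uv: "u \<in> set ts" "v \<in> set ts" using xs ys ts by (auto simp: u_def v_def)
    moreover have "?a \<in> {0..T}" "?b \<in> {0..T}" using 1 ab by blast+
    ultimately have r: "?a \<le> u" "v \<le> ?b" "0 \<le> ?a" "?b \<le> T"
      using 1 sorted_wrt_hd_le sorted_wrt_le_last by auto
    have half: "((?b - ?a) / 2) powr \<theta> = (1 / 2) powr \<theta> * (?b - ?a) powr \<theta>"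
      using True by (simp add: powr_divide)
    have "\<bar>psum \<Xi> xs - \<Xi> ?a u\<bar> \<le> K * (u - ?a) powr \<theta>"
      using 1 xs ys ts hl unfolding u_def by (metis append_is_Nil_conv length_append length_greater_0_conv less_add_same_cancel1 sorted_wrt_append le_sup_iff set_append)
    also have "\<dots> \<le> K * ((?b - ?a) / 2) powr \<theta>"
      using sewing_constant_fixpoint(1) um r theta by (intro mult_left_mono powr_mono2) (auto simp: m_def field_simps)
    finally have b1: "\<bar>psum \<Xi> xs - \<Xi> ?a u\<bar> \<le> K * (1 / 2) powr \<theta> * (?b - ?a) powr \<theta>"
      unfolding half by simp
    have "\<bar>psum \<Xi> ys - \<Xi> v ?b\<bar> \<le> K * (?b - v) powr \<theta>"
      using 1 xs ys ts hl unfolding v_def by (metis append_is_Nil_conv length_append length_greater_0_conv less_add_same_cancel2 sorted_wrt_append le_sup_iff set_append)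
    also have "\<dots> \<le> K * ((?b - ?a) / 2) powr \<theta>"
      using sewing_constant_fixpoint(1) mv r theta by (intro mult_left_mono powr_mono2) (auto simp: m_def field_simps)
    finally have b2: "\<bar>psum \<Xi> ys - \<Xi> v ?b\<bar> \<le> K * (1 / 2) powr \<theta> * (?b - ?a) powr \<theta>"
      unfolding half by simp
    have b3: "\<bar>\<Xi> ?a ?b - \<Xi> ?a u - \<Xi> u ?b\<bar> \<le> C * (?b - ?a) powr \<theta>"
      using um mv m r by (intro almost_additive) auto
    have "\<bar>\<Xi> u ?b - \<Xi> u v - \<Xi> v ?b\<bar> \<le> C * (?b - u) powr \<theta>"
      using um mv m r by (intro almost_additive) auto
    also have "\<dots> \<le> C * (?b - ?a) powr \<theta>"
      using C um m r theta by (intro mult_left_mono powr_mono2) auto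
    finally have b4: "\<bar>\<Xi> u ?b - \<Xi> u v - \<Xi> v ?b\<bar> \<le> C * (?b - ?a) powr \<theta>" .
    have "psum \<Xi> ts = psum \<Xi> xs + \<Xi> u v + psum \<Xi> ys"
      unfolding u_def v_def using psum_append[OF xs ys] ts by simp
    then have "\<bar>psum \<Xi> ts - \<Xi> ?a ?b\<bar> \<le>
        K * (1 / 2) powr \<theta> * (?b - ?a) powr \<theta> + K * (1 / 2) powr \<theta> * (?b - ?a) powr \<theta>
        + C * (?b - ?a) powr \<theta> + C * (?b - ?a) powr \<theta>"
      using b1 b2 b3 b4 by linarith
    also have "\<dots> = (2 * K * (1 / 2) powr \<theta> + 2 * C) * (?b - ?a) powr \<theta>"
      by (simp add: algebra_simps)
    finally show ?thesis unfolding sewing_constant_fixpoint(2) .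
  qed
qed

text \<open>Refining \<open>\<pi>\<close> to \<open>\<sigma>\<close> partitions each interval of \<open>\<pi>\<close>, and \<open>sewing_bound\<close> applies to each of them.\<close>

lemma sewing_refine:
  assumes "\<pi> \<noteq> []" "sorted_wrt (<) \<pi>" "sorted_wrt (<) \<sigma>" "set \<pi> \<subseteq> set \<sigma>" "set \<sigma> \<subseteq> {0..T}"
    and "hd \<sigma> = hd \<pi>" "last \<sigma> = last \<pi>"
  shows "\<bar>psum \<Xi> \<sigma> - psum \<Xi> \<pi>\<bar> \<le> K * psum (\<lambda>u v. (v - u) powr \<theta>) \<pi>"
  using assms
proof (induction \<pi> arbitrary: \<sigma>)
  case (Cons u \<rho>)
  show ?case
  proof (cases \<rho>)
    case Nil
    then have "hd \<sigma> = u" "last \<sigma> = u" "u \<in> set \<sigma>" using Cons.prems by auto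
    then have "\<sigma> = [u]"
      using Cons.prems(3) by (cases \<sigma>) (auto split: if_splits dest: sorted_wrt_le_last)
    then show ?thesis using Nil by simp
  next
    case v: (Cons v r)
    obtain xs ys where \<sigma>: "\<sigma> = xs @ v # ys"
      using Cons.prems(4) v by (metis list.set_intros subsetD split_list)
    have "u < v" using Cons.prems(2) v by simp
    moreover have "hd \<sigma> = u" using Cons.prems(6) by simp
    ultimately have xs: "xs \<noteq> []" "hd xs = u" using \<sigma> by (auto simp: hd_append split: if_splits)
    have r: "set r \<subseteq> set ys"
    proof
      fix z assume z: "z \<in> set r"
      then have "v < z" "z \<in> set \<sigma>" using Cons.prems(2,4) v by auto
      then show "z \<in> set ys" using Cons.prems(3) \<sigma> by (fastforce simp: sorted_wrt_append)
    qed
    have "\<bar>psum \<Xi> (xs @ [v]) - \<Xi> (hd (xs @ [v])) (last (xs @ [v]))\<bar>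
        \<le> K * (last (xs @ [v]) - hd (xs @ [v])) powr \<theta>"
      using Cons.prems(3,5) \<sigma> by (intro sewing_bound) (auto simp: sorted_wrt_append)
    then have 1: "\<bar>psum \<Xi> (xs @ [v]) - \<Xi> u v\<bar> \<le> K * (v - u) powr \<theta>" using xs by simp
    have 2: "\<bar>psum \<Xi> (v # ys) - psum \<Xi> (v # r)\<bar> \<le> K * psum (\<lambda>u v. (v - u) powr \<theta>) (v # r)"
      using Cons.prems \<sigma> v r Cons.IH[of "v # ys"] by (auto simp: sorted_wrt_append)
    have "psum \<Xi> \<sigma> = psum \<Xi> (xs @ [v]) + psum \<Xi> (v # ys)"
      unfolding \<sigma> by (rule psum_append_overlap)
    then show ?thesis using 1 2 v by (simp add: distrib_left)
  qed
qed simp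

end

text \<open>The sets of partitions of mesh below \<open>\<delta>\<close> decrease with \<open>\<delta>\<close>, so they form a base of the filter.\<close>

lemma eventually_mesh_filter:
  "eventually P (mesh_filter t) \<longleftrightarrow>
    (\<exists>\<delta>>0. \<forall>ts\<in>partitions t. successively (\<lambda>u v. v - u < \<delta>) ts \<longrightarrow> P ts)"
proof -
  have eq: "(\<forall>j < length ts - 1. ts ! Suc j - ts ! j < \<delta>) \<longleftrightarrow> successively (\<lambda>u v. v - u < \<delta>) ts"
    for ts :: "real list" and \<delta>
    by (auto simp: successively_conv_nth)
  have "eventually P (mesh_filter t) \<longleftrightarrow> (\<exists>\<delta>\<in>{0<..}. eventually P (principal
     {ts \<in> partitions t. \<forall>j < length ts - 1. ts ! Suc j - ts ! j < \<delta>}))"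
    unfolding mesh_filter_def
  proof (rule eventually_INF_base)
    fix a b :: real assume "a \<in> {0<..}" "b \<in> {0<..}"
    then show "\<exists>x\<in>{0<..}. principal {ts \<in> partitions t. \<forall>j<length ts - 1. ts ! Suc j - ts ! j < x}
      \<le> inf (principal {ts \<in> partitions t. \<forall>j<length ts - 1. ts ! Suc j - ts ! j < a})
             (principal {ts \<in> partitions t. \<forall>j<length ts - 1. ts ! Suc j - ts ! j < b})"
      by (intro bexI[of _ "min a b"]) auto
  qed auto
  then show ?thesis unfolding eq eventually_principal by auto
qed

text \<open>Uniform partitions have arbitrarily small mesh. This is what makes limits along the filter unique.\<close>

lemma mesh_filter_neq_bot:
  assumes "0 \<le> t"
  shows "mesh_filter t \<noteq> bot"
proof -
  have "\<exists>ts\<in>partitions t. successively (\<lambda>u v. v - u < \<delta>) ts" if d: "0 < \<delta>" for \<delta>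
  proof (cases "t = 0")
    case True
    then show ?thesis by (intro bexI[of _ "[0]"]) (auto simp: partitions_def)
  next
    case False
    then have t: "0 < t" using assms by simp
    obtain n where n: "t / \<delta> < real n" using reals_Archimedean2 by blast
    then have n0: "0 < real n" using t d by (smt (verit) divide_pos_pos)
    define ts where "ts = map (\<lambda>j. real j * (t / real n)) [0..<Suc n]"
    have "sorted_wrt (<) ts" unfolding ts_def sorted_wrt_map
      using t n0 by (auto simp: sorted_wrt_iff_nth_less divide_strict_right_mono simp del: upt_Suc)
    moreover have "hd ts = 0" unfolding ts_def by (simp del: upt_Suc add: hd_map)
    moreover have "last ts = t" unfolding ts_def using n0 by simp
    moreover have "successively (\<lambda>u v. v - u < \<delta>) ts"
    proof -
      have "t / real n < \<delta>" using n n0 d by (simp add: field_simps)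
      then show ?thesis unfolding ts_def
        by (auto simp: successively_conv_nth distrib_right add_divide_distrib simp del: upt_Suc)
    qed
    ultimately show ?thesis by (intro bexI[of _ ts]) (auto simp: partitions_def ts_def)
  qed
  then have "\<not> eventually (\<lambda>_. False) (mesh_filter t)" unfolding eventually_mesh_filter by blast
  then show ?thesis by (simp add: trivial_limit_def)
qed

lemma mesh_filter_convergent:
  fixes f :: "real list \<Rightarrow> real"
  assumes "0 \<le> t" and "\<And>e. 0 < e \<Longrightarrow> \<exists>\<delta>>0. \<forall>\<pi>\<in>partitions t. \<forall>\<rho>\<in>partitions t.
      successively (\<lambda>u v. v - u < \<delta>) \<pi> \<longrightarrow> successively (\<lambda>u v. v - u < \<delta>) \<rho> \<longrightarrow> \<bar>f \<pi> - f \<rho>\<bar> < e"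
  shows "\<exists>I. (f \<longlongrightarrow> I) (mesh_filter t)"
proof -
  have "cauchy_filter (filtermap f (mesh_filter t))"
    unfolding cauchy_filter_metric_filtermap
  proof (intro allI impI)
    fix e :: real assume "0 < e"
    from assms(2)[OF this] obtain \<delta> where \<delta>: "0 < \<delta>" "\<forall>\<pi>\<in>partitions t. \<forall>\<rho>\<in>partitions t.
      successively (\<lambda>u v. v - u < \<delta>) \<pi> \<longrightarrow> successively (\<lambda>u v. v - u < \<delta>) \<rho> \<longrightarrow> \<bar>f \<pi> - f \<rho>\<bar> < e"
      by blast
    let ?P = "\<lambda>ts. ts \<in> partitions t \<and> successively (\<lambda>u v. v - u < \<delta>) ts"
    have "eventually ?P (mesh_filter t)" using \<delta>(1) unfolding eventually_mesh_filter by blast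
    then show "\<exists>P. eventually P (mesh_filter t) \<and> (\<forall>x y. P x \<and> P y \<longrightarrow> dist (f x) (f y) < e)"
      using \<delta>(2) by (intro exI[of _ ?P]) (auto simp: dist_real_def)
  qed
  then have "\<exists>I\<in>UNIV. filtermap f (mesh_filter t) \<le> nhds I"
    using complete_UNIV[where 'a = real] mesh_filter_neq_bot[OF assms(1)]
    unfolding complete_uniform by (simp add: filtermap_bot_iff)
  then show ?thesis by (auto simp: filterlim_def)
qed

lemma partitions_subset: "ts \<in> partitions t \<Longrightarrow> set ts \<subseteq> {0..t}"
  using sorted_wrt_hd_le sorted_wrt_le_last by (fastforce simp: partitions_def)

lemma mesh_powr_small:
  fixes K t \<theta> e :: real
  assumes "0 \<le> K" "1 < \<theta>" "0 < e" "0 \<le> t"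
  shows "\<exists>\<delta>>0. K * (\<delta> powr (\<theta> - 1) * t) < e"
proof -
  \<comment> \<open>The summand 1 only keeps the denominator positive when \<open>K * t = 0\<close>.\<close>
  define \<delta> where "\<delta> = (e / (K * t + 1)) powr (1 / (\<theta> - 1))"
  have p: "0 < K * t + 1" using assms by (smt (verit) mult_nonneg_nonneg)
  have "\<delta> powr (\<theta> - 1) = e / (K * t + 1)" using assms p by (simp add: \<delta>_def powr_powr)
  then have "K * (\<delta> powr (\<theta> - 1) * t) = e * (K * t / (K * t + 1))" by simp
  also have "\<dots> < e * 1" using assms p by (intro mult_strict_left_mono) (auto simp: divide_simps)
  finally show ?thesis using assms p by (intro exI[of _ \<delta>]) (auto simp: \<delta>_def)
qed

text \<open>Two partitions of small mesh are compared through their common refinement. By \<open>sewing_refine\<close> each of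
them is off by at most a constant times the sum of \<open>(v - u) powr \<theta>\<close> over its intervals, and this tends to
\<open>0\<close> with the mesh because \<open>\<theta> > 1\<close>.\<close>

lemma sewing:
  fixes \<Xi> :: "real \<Rightarrow> real \<Rightarrow> real"
  assumes "1 < \<theta>" "0 \<le> C" "t \<in> {0..T}"
    and aa: "\<And>s u t. 0 \<le> s \<Longrightarrow> s \<le> u \<Longrightarrow> u \<le> t \<Longrightarrow> t \<le> T \<Longrightarrow>
      \<bar>\<Xi> s t - \<Xi> s u - \<Xi> u t\<bar> \<le> C * (t - s) powr \<theta>"
  shows "\<exists>I. (psum \<Xi> \<longlongrightarrow> I) (mesh_filter t)"
proof (rule mesh_filter_convergent)
  show t: "0 \<le> t" using assms by simp
  define K where "K = sewing_constant C \<theta>"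
  have K: "0 \<le> K" unfolding K_def by (rule sewing_constant_fixpoint(1)[OF assms(1,2) aa])
  fix e :: real assume "0 < e"
  then obtain \<delta> where \<delta>: "0 < \<delta>" "K * (\<delta> powr (\<theta> - 1) * t) < e / 2"
    using mesh_powr_small[OF K assms(1) _ t, of "e / 2"] by auto
  have refine: "\<bar>psum \<Xi> \<sigma> - psum \<Xi> \<pi>\<bar> < e / 2"
    if "\<pi> \<in> partitions t" "successively (\<lambda>u v. v - u < \<delta>) \<pi>" "\<sigma> \<in> partitions t" "set \<pi> \<subseteq> set \<sigma>" for \<pi> \<sigma>
  proof -
    have "\<bar>psum \<Xi> \<sigma> - psum \<Xi> \<pi>\<bar> \<le> K * psum (\<lambda>u v. (v - u) powr \<theta>) \<pi>"
      unfolding K_def using that partitions_subset[OF that(3)] assms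
      by (intro sewing_refine[OF assms(1,2) aa]) (auto simp: partitions_def)
    also have "psum (\<lambda>u v. (v - u) powr \<theta>) \<pi> \<le> \<delta> powr (\<theta> - 1) * t"
      using psum_powr_le_mesh[of \<pi> \<delta> \<theta>] that \<delta> assms(1) by (auto simp: partitions_def)
    finally show ?thesis using \<delta> K by (simp add: mult_left_mono)
  qed
  have "\<bar>psum \<Xi> \<pi> - psum \<Xi> \<rho>\<bar> < e"
    if p: "\<pi> \<in> partitions t" "successively (\<lambda>u v. v - u < \<delta>) \<pi>"
      "\<rho> \<in> partitions t" "successively (\<lambda>u v. v - u < \<delta>) \<rho>" for \<pi> \<rho>
  proof -
    define \<sigma> where "\<sigma> = sorted_list_of_set (set \<pi> \<union> set \<rho>)"
    have set: "set \<sigma> = set \<pi> \<union> set \<rho>" and sorted: "sorted_wrt (<) \<sigma>" by (auto simp: \<sigma>_def)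
    have sub: "set \<sigma> \<subseteq> {0..t}" unfolding set using partitions_subset p by blast
    have "\<pi> \<noteq> []" "0 = hd \<pi>" "t = last \<pi>" using p by (auto simp: partitions_def)
    then have el: "0 \<in> set \<sigma>" "t \<in> set \<sigma>" unfolding set by (metis UnI1 hd_in_set, metis UnI1 last_in_set)
    then have ne: "\<sigma> \<noteq> []" by auto
    have "hd \<sigma> = 0" using sorted_wrt_hd_le[OF sorted el(1)] sub ne by (metis atLeastAtMost_iff antisym hd_in_set subsetD)
    moreover have "last \<sigma> = t" using sorted_wrt_le_last[OF sorted el(2)] sub ne by (metis atLeastAtMost_iff antisym last_in_set subsetD)
    ultimately have "\<sigma> \<in> partitions t" using ne sorted by (simp add: partitions_def)
    then have "\<bar>psum \<Xi> \<sigma> - psum \<Xi> \<pi>\<bar> < e / 2" "\<bar>psum \<Xi> \<sigma> - psum \<Xi> \<rho>\<bar> < e / 2"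
      using refine p set by simp_all
    then show ?thesis by linarith
  qed
  then show "\<exists>\<delta>>0. \<forall>\<pi>\<in>partitions t. \<forall>\<rho>\<in>partitions t.
      successively (\<lambda>u v. v - u < \<delta>) \<pi> \<longrightarrow> successively (\<lambda>u v. v - u < \<delta>) \<rho>
      \<longrightarrow> \<bar>psum \<Xi> \<pi> - psum \<Xi> \<rho>\<bar> < e"
    using \<delta>(1) by blast
qed

text \<open>If \<open>\<Xi>\<close> agrees with the increments of \<open>g\<close> up to order \<open>\<theta> > 1\<close>, the errors vanish in the limit and the
sums telescope.\<close>

lemma psum_tendsto_increment:
  assumes "1 < \<theta>" "0 \<le> C" "t \<in> {0..T}"
    and near: "\<And>u v. 0 \<le> u \<Longrightarrow> u \<le> v \<Longrightarrow> v \<le> T \<Longrightarrow> \<bar>\<Xi> u v - (g v - g u)\<bar> \<le> C * (v - u) powr \<theta>"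
  shows "(psum \<Xi> \<longlongrightarrow> g t - g 0) (mesh_filter t)"
proof (rule tendstoI)
  have t: "0 \<le> t" using assms by simp
  fix e :: real assume "0 < e"
  then obtain \<delta> where \<delta>: "0 < \<delta>" "C * (\<delta> powr (\<theta> - 1) * t) < e"
    using mesh_powr_small[OF assms(2,1) _ t, of e] by auto
  have "dist (psum \<Xi> \<pi>) (g t - g 0) < e"
    if p: "\<pi> \<in> partitions t" "successively (\<lambda>u v. v - u < \<delta>) \<pi>" for \<pi>
  proof -
    have "psum \<Xi> \<pi> - (g t - g 0) = psum (\<lambda>u v. \<Xi> u v - (g v - g u)) \<pi>"
      using p psum_telescope[of \<pi> g] psum_diff[of \<Xi> "\<lambda>u v. g v - g u" \<pi>] by (simp add: partitions_def)
    also have "\<bar>\<dots>\<bar> \<le> psum (\<lambda>u v. C * (v - u) powr \<theta>) \<pi>"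
      using p partitions_subset[OF p(1)] assms(3)
      by (intro psum_mono[of _ "{0..t}"] near) (auto simp: partitions_def)
    also have "\<dots> = C * psum (\<lambda>u v. (v - u) powr \<theta>) \<pi>" by (rule psum_cmult)
    also have "psum (\<lambda>u v. (v - u) powr \<theta>) \<pi> \<le> \<delta> powr (\<theta> - 1) * t"
      using psum_powr_le_mesh[of \<pi> \<delta> \<theta>] p \<delta> assms(1) by (auto simp: partitions_def)
    finally show ?thesis using \<delta> assms(2) by (simp add: dist_real_def mult_left_mono)
  qed
  then show "eventually (\<lambda>\<pi>. dist (psum \<Xi> \<pi>) (g t - g 0) < e) (mesh_filter t)"
    using \<delta>(1) unfolding eventually_mesh_filter by blast
qed

section \<open>Rough paths on divided powers\<close>

text \<open>The pairs (prefix, suffix) of a word are pairwise distinct, since their lengths differ, so no coefficients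
of the coproduct merge.\<close>

lemma convolution_word_vec:
  "convolution f g (word_vec w) = (\<Sum>i\<le>length w. f (word_vec (take i w)) * g (word_vec (drop i w)))"
proof -
  let ?p = "\<lambda>i. (take i w, drop i w)"
  let ?z = "\<Sum>i\<le>length w. Poly_Mapping.single (?p i) (1::real)"
  have inj: "inj_on ?p {..length w}"
    by (rule inj_onI) (metis Pair_inject atMost_iff length_take min.absorb2)
  have z: "deconcat (word_vec w) = ?z"
    by (simp add: deconcat_def)
  have look: "Poly_Mapping.lookup ?z (?p i) = 1" if "i \<le> length w" for i
  proof -
    have "Poly_Mapping.lookup ?z (?p i) = (\<Sum>j\<le>length w. if j = i then 1 else 0)"
      unfolding lookup_sum lookup_single
    proof (rule sum.cong[OF refl])
      fix j assume "j \<in> {..length w}"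
      then have "?p j = ?p i \<longleftrightarrow> j = i" using that by (intro inj_on_eq_iff[OF inj]) auto
      then show "(1 when ?p j = ?p i) = (if j = i then 1 else 0 :: real)" by (simp only: when_def)
    qed
    then show ?thesis using that by simp
  qed
  have keys: "Poly_Mapping.keys ?z \<subseteq> ?p ` {..length w}"
  proof
    fix k assume "k \<in> Poly_Mapping.keys ?z"
    then have "(\<Sum>i\<le>length w. Poly_Mapping.lookup (Poly_Mapping.single (?p i) (1::real)) k) \<noteq> 0"
      by (simp add: in_keys_iff lookup_sum)
    then obtain i where "i \<le> length w" "Poly_Mapping.lookup (Poly_Mapping.single (?p i) (1::real)) k \<noteq> 0"
      by (metis (no_types, lifting) atMost_iff sum.neutral)
    then show "k \<in> ?p ` {..length w}" by (auto simp: lookup_single when_def split: if_splits)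
  qed
  have "convolution f g (word_vec w) = (\<Sum>(u, v)\<in>?p ` {..length w}.
      Poly_Mapping.lookup ?z (u, v) * (f (word_vec u) * g (word_vec v)))"
    unfolding convolution_def tensor_pairing_def z
    using keys by (intro sum.mono_neutral_left) (auto simp: in_keys_iff)
  also have "\<dots> = (\<Sum>i\<le>length w. f (word_vec (take i w)) * g (word_vec (drop i w)))"
    by (subst sum.reindex[OF inj]) (simp add: look)
  finally show ?thesis .
qed

lemma qshuffle_word_vec: "qshuffle \<gamma> (word_vec v) (word_vec w) = qsh_word \<gamma> v w"
  by (simp add: qshuffle_def)

abbreviation trunc_words :: "real \<Rightarrow> nat \<Rightarrow> 'd::finite word set" where
  "trunc_words \<gamma> n \<equiv> {w \<in> words \<gamma>. weight w \<le> n}"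

lemma weight_simps [simp]:
  "weight [] = 0" "weight (a # w) = mdeg a + weight w" "weight (v @ w) = weight v + weight w"
  by (simp_all add: weight_def)

lemma compositions_conv_trunc_words: "mdeg l \<le> n \<Longrightarrow> compositions \<gamma> l = {w \<in> trunc_words \<gamma> n. sum_list w = l}"
  by (auto simp: compositions_def weight_conv_mdeg)

lemma take_drop_trunc_words:
  assumes "w \<in> trunc_words \<gamma> n"
  shows "take i w \<in> trunc_words \<gamma> n" "drop i w \<in> trunc_words \<gamma> n"
proof -
  have w: "take i w @ drop i w = w" by simp
  then have "weight (take i w) + weight (drop i w) = weight w" by (metis weight_simps(3))
  moreover have "take i w \<in> words \<gamma> \<and> drop i w \<in> words \<gamma>"
    using assms w by (metis (no_types, lifting) mem_Collect_eq words_append)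
  ultimately show "take i w \<in> trunc_words \<gamma> n" "drop i w \<in> trunc_words \<gamma> n" using assms by auto
qed

lemma word_vec_trunc_space: "w \<in> trunc_words \<gamma> (Ngam \<gamma>) \<Longrightarrow> word_vec w \<in> trunc_space \<gamma>"
  unfolding trunc_space_def by (rule span_base) auto

lemma trunc_dual_sum:
  assumes f: "f \<in> trunc_dual \<gamma>" and S: "finite S" "S \<subseteq> trunc_words \<gamma> (Ngam \<gamma>)"
  shows "f (\<Sum>w\<in>S. c w *\<^sub>R word_vec w) = (\<Sum>w\<in>S. c w * f (word_vec w))
    \<and> (\<Sum>w\<in>S. c w *\<^sub>R word_vec w) \<in> trunc_space \<gamma>"
  using S
proof (induction S)
  case empty
  have 0: "0 \<in> trunc_space \<gamma>" by (simp add: trunc_space_def span_zero)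
  then have "f (0 *\<^sub>R 0) = 0 * f 0" using f unfolding trunc_dual_def by blast
  then show ?case using 0 by simp
next
  case (insert w S)
  have w: "word_vec w \<in> trunc_space \<gamma>" using insert by (intro word_vec_trunc_space) auto
  then have cw: "c w *\<^sub>R word_vec w \<in> trunc_space \<gamma>" unfolding trunc_space_def by (rule span_scale)
  have "f (c w *\<^sub>R word_vec w) = c w * f (word_vec w)" using f w unfolding trunc_dual_def by blast
  moreover have "f (c w *\<^sub>R word_vec w + (\<Sum>w\<in>S. c w *\<^sub>R word_vec w))
      = f (c w *\<^sub>R word_vec w) + f (\<Sum>w\<in>S. c w *\<^sub>R word_vec w)"
    using f cw insert unfolding trunc_dual_def by auto
  moreover have "c w *\<^sub>R word_vec w + (\<Sum>w\<in>S. c w *\<^sub>R word_vec w) \<in> trunc_space \<gamma>"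
    using cw insert unfolding trunc_space_def by (auto intro: span_add)
  ultimately show ?case using insert by simp
qed

lemma compositions_trunc_words: "mdeg l \<le> n \<Longrightarrow> compositions \<gamma> l \<subseteq> trunc_words \<gamma> n"
  by (auto simp: compositions_def weight_conv_mdeg)

context
  fixes \<gamma> T :: real
    and x :: "real \<Rightarrow> ('d::{finite,linorder}) point"
    and X :: "real \<Rightarrow> real \<Rightarrow> ('d word \<Rightarrow>\<^sub>0 real) \<Rightarrow> real"
  assumes N1: "1 \<le> Ngam \<gamma>"
    and rp: "quasi_geometric_rough_path \<gamma> T X"
    and over: "\<And>s t i. s \<in> {0..T} \<Longrightarrow> t \<in> {0..T} \<Longrightarrow> X s t (word_vec [axis i 1]) = x t $ i - x s $ i"
begin

private abbreviation (input) A where "A s t w \<equiv> X s t (word_vec w)"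
private abbreviation (input) N where "N \<equiv> Ngam \<gamma>"

lemma rough_path_dual: "s \<in> {0..T} \<Longrightarrow> t \<in> {0..T} \<Longrightarrow> X s t \<in> trunc_dual \<gamma>"
  using rp unfolding quasi_geometric_rough_path_def by blast

lemma rough_path_mult:
  "s \<in> {0..T} \<Longrightarrow> t \<in> {0..T} \<Longrightarrow> y \<in> trunc_space \<gamma> \<Longrightarrow> z \<in> trunc_space \<gamma> \<Longrightarrow>
    qshuffle \<gamma> y z \<in> trunc_space \<gamma> \<Longrightarrow> X s t (qshuffle \<gamma> y z) = X s t y * X s t z"
  using rp unfolding quasi_geometric_rough_path_def by blast

lemma chen:
  assumes "s \<in> {0..T}" "u \<in> {0..T}" "t \<in> {0..T}" "w \<in> trunc_words \<gamma> N"
  shows "A s t w = (\<Sum>i\<le>length w. A s u (take i w) * A u t (drop i w))"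
proof -
  have "convolution (X s u) (X u t) (word_vec w) = X s t (word_vec w)"
    using rp assms word_vec_trunc_space[OF assms(4)] unfolding quasi_geometric_rough_path_def by blast
  then show ?thesis by (simp add: convolution_word_vec)
qed

lemma rough_path_unit:
  assumes "s \<in> {0..T}" "t \<in> {0..T}" "w \<in> trunc_words \<gamma> N"
  shows "A s t w = A s t [] * A s t w"
proof -
  have "qshuffle \<gamma> (word_vec []) (word_vec w) = word_vec w"
    by (simp add: qshuffle_word_vec qsh_word_rec)
  then show ?thesis
    using rough_path_mult[OF assms(1,2), of "word_vec []" "word_vec w"]
      word_vec_trunc_space[OF assms(3)] word_vec_trunc_space[of "[]" \<gamma>] by simp
qed

text \<open>The axioms of a rough path do not fix its value on the empty word. Multiplicativity makes this value
idempotent, and if it vanishes for one pair of times, then the functional vanishes there, since the empty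
word is the unit; Chen's relation spreads this to all pairs. In the second case the underlying path is
constant and every rough sum is zero.\<close>

lemma rough_path_dichotomy:
  "(\<forall>s\<in>{0..T}. \<forall>t\<in>{0..T}. A s t [] = 1) \<or>
   (\<forall>s\<in>{0..T}. \<forall>t\<in>{0..T}. \<forall>w\<in>trunc_words \<gamma> N. A s t w = 0)"
proof (rule disjCI)
  assume "\<not> (\<forall>s\<in>{0..T}. \<forall>t\<in>{0..T}. \<forall>w\<in>trunc_words \<gamma> N. A s t w = 0)"
  then obtain a b w where ab: "a \<in> {0..T}" "b \<in> {0..T}" "w \<in> trunc_words \<gamma> N" "A a b w \<noteq> 0" by blast
  then have 1: "A a b [] \<noteq> 0" using rough_path_unit[OF ab(1-3)] by auto
  show "\<forall>s\<in>{0..T}. \<forall>t\<in>{0..T}. A s t [] = 1"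
  proof (intro ballI)
    fix s t assume st: "s \<in> {0..T}" "t \<in> {0..T}"
    have "A a b [] = A a s [] * (A s t [] * A t b [])"
      using chen[of a s b "[]"] chen[of s t b "[]"] ab st by simp
    then have "A s t [] \<noteq> 0" using 1 by auto
    moreover have "A s t [] = A s t [] * A s t []" by (rule rough_path_unit) (use st in auto)
    ultimately show "A s t [] = 1" by simp
  qed
qed

lemma divpow_trunc_space:
  assumes "mdeg l \<le> N" "s \<in> {0..T}" "t \<in> {0..T}"
  shows "c *\<^sub>R divpow \<gamma> l \<in> trunc_space \<gamma>"
    "X s t (c *\<^sub>R divpow \<gamma> l) = c * (\<Sum>w\<in>compositions \<gamma> l. wcoeff w * A s t w)"
proof -
  have eq: "c *\<^sub>R divpow \<gamma> l = (\<Sum>w\<in>compositions \<gamma> l. (c * wcoeff w) *\<^sub>R word_vec w)"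
    by (simp add: divpow_def scaleR_sum_right)
  show "c *\<^sub>R divpow \<gamma> l \<in> trunc_space \<gamma>"
    "X s t (c *\<^sub>R divpow \<gamma> l) = c * (\<Sum>w\<in>compositions \<gamma> l. wcoeff w * A s t w)"
    unfolding eq
    using trunc_dual_sum[OF rough_path_dual[OF assms(2,3)] finite_compositions compositions_trunc_words[OF assms(1)], of "\<lambda>w. c * wcoeff w"]
    by (simp_all add: sum_distrib_left mult.assoc)
qed

lemma rough_path_axis_power:
  assumes "s \<in> {0..T}" "t \<in> {0..T}" "A s t [] = 1" "n \<le> N"
  shows "X s t (qsh_power \<gamma> (word_vec [axis i 1]) n) = (x t $ i - x s $ i) ^ n"
  using assms(4)
proof (induction n)
  case (Suc n)
  have mdeg: "mdeg (axis i m :: 'd mindex) = m" for m by (simp add: mdeg_def axis_def)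
  have tr: "qsh_power \<gamma> (word_vec [axis i 1]) m \<in> trunc_space \<gamma>" if "m \<le> N" for m
    unfolding qsh_power_axis[OF N1] using that assms by (intro divpow_trunc_space) (auto simp: mdeg)
  have tr1: "word_vec [axis i 1] \<in> trunc_space \<gamma>"
    using divpow_trunc_space(1)[OF _ assms(1,2), of "axis i 1" 1] N1 divpow_axis[OF N1, of i] by simp
  have "X s t (qshuffle \<gamma> (word_vec [axis i 1]) (qsh_power \<gamma> (word_vec [axis i 1]) n))
    = X s t (word_vec [axis i 1]) * X s t (qsh_power \<gamma> (word_vec [axis i 1]) n)"
    using tr[of "Suc n"] tr[of n] tr1 Suc.prems assms(1,2) by (intro rough_path_mult) auto
  then show ?case using Suc over[OF assms(1,2), of i] by simp
qed (use assms in simp)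

lemma rough_path_axis_factors:
  assumes "s \<in> {0..T}" "t \<in> {0..T}" "A s t [] = 1" "mdeg l \<le> N" "distinct xs"
  shows "X s t (axis_factors \<gamma> l xs) = (\<Prod>i\<in>set xs. (x t $ i - x s $ i) ^ (l $ i))"
  using assms(5)
proof (induction xs)
  case (Cons i xs)
  have "mdeg (\<chi> i. if i \<in> S then l $ i else 0) \<le> mdeg l" for S
    unfolding mdeg_def by (rule sum_mono) auto
  then have tr: "axis_factors \<gamma> l ys \<in> trunc_space \<gamma>" if "distinct ys" for ys
    unfolding axis_factors_divpow[OF N1 that] using assms
    by (intro divpow_trunc_space) (auto intro: order_trans)
  have li: "l $ i \<le> N" using assms(4) member_le_sum[of i UNIV "\<lambda>i. l $ i"] by (auto simp: mdeg_def)
  have "mdeg (axis i (l $ i) :: 'd mindex) = l $ i" by (simp add: mdeg_def axis_def)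
  then have tri: "qsh_power \<gamma> (word_vec [axis i 1]) (l $ i) \<in> trunc_space \<gamma>"
    unfolding qsh_power_axis[OF N1] using assms li by (intro divpow_trunc_space) auto
  have "X s t (qshuffle \<gamma> (qsh_power \<gamma> (word_vec [axis i 1]) (l $ i)) (axis_factors \<gamma> l xs))
    = X s t (qsh_power \<gamma> (word_vec [axis i 1]) (l $ i)) * X s t (axis_factors \<gamma> l xs)"
    using tr[of xs] tr[of "i # xs"] tri Cons.prems assms(1,2) by (intro rough_path_mult) auto
  then show ?case using Cons rough_path_axis_power[OF assms(1-3) li, of i] by simp
qed (use assms in simp)

text \<open>A functional that respects the product takes the monomial in the letters \<open>e_i\<close> to the monomial in the
increments of the path. Dividing by \<open>l!\<close> gives its value on the divided power.\<close>

lemma rough_path_compositions: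
  assumes "s \<in> {0..T}" "t \<in> {0..T}" "A s t [] = 1" "mdeg l \<le> N"
  shows "(\<Sum>w\<in>compositions \<gamma> l. wcoeff w * A s t w) = divmon (x t - x s) l"
proof -
  have "X s t (qsh_monomial \<gamma> l) = (\<Prod>i\<in>UNIV. (x t $ i - x s $ i) ^ (l $ i))"
    using rough_path_axis_factors[OF assms, of coords] by (simp add: qsh_monomial_def)
  then have "real (mfact l) * (\<Sum>w\<in>compositions \<gamma> l. wcoeff w * A s t w) = (\<Prod>i\<in>UNIV. (x t $ i - x s $ i) ^ (l $ i))"
    unfolding qsh_monomial_divpow[OF N1] divpow_trunc_space(2)[OF assms(4,1,2)] .
  moreover have "divmon (x t - x s) l = (\<Prod>i\<in>UNIV. (x t $ i - x s $ i) ^ (l $ i)) / real (mfact l)"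
    by (simp add: divmon_def mfact_def prod_dividef)
  ultimately have "real (mfact l) * (\<Sum>w\<in>compositions \<gamma> l. wcoeff w * A s t w)
      = real (mfact l) * divmon (x t - x s) l"
    by simp
  then show ?thesis by simp
qed

text \<open>Grouping words by the multi-index they sum up to turns the expansion over words into the Taylor
polynomial.\<close>

lemma rough_path_taylor:
  assumes "s \<in> {0..T}" "t \<in> {0..T}" "A s t [] = 1" "n \<le> N"
  shows "(\<Sum>w\<in>trunc_words \<gamma> n. mpartial (sum_list w) f (x s) * wcoeff w * A s t w)
    = taylor (Suc n) f (x s) (x t - x s)"
proof -
  have "(\<Sum>w\<in>trunc_words \<gamma> n. mpartial (sum_list w) f (x s) * wcoeff w * A s t w)
    = (\<Sum>l | mdeg l \<le> n. \<Sum>w | w \<in> trunc_words \<gamma> n \<and> sum_list w = l.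
         mpartial (sum_list w) f (x s) * wcoeff w * A s t w)"
    by (rule sum.group[OF finite_words_weight_le, symmetric]) (auto simp: weight_conv_mdeg)
  also have "\<dots> = (\<Sum>l | mdeg l \<le> n. mpartial l f (x s) * divmon (x t - x s) l)"
  proof (intro sum.cong refl)
    fix l :: "'d mindex" assume l: "l \<in> {l. mdeg l \<le> n}"
    have "(\<Sum>w | w \<in> trunc_words \<gamma> n \<and> sum_list w = l. mpartial (sum_list w) f (x s) * wcoeff w * A s t w)
      = mpartial l f (x s) * (\<Sum>w\<in>compositions \<gamma> l. wcoeff w * A s t w)"
      using l by (simp add: compositions_conv_trunc_words[of l n] sum_distrib_left mult.assoc)
    then show "(\<Sum>w | w \<in> trunc_words \<gamma> n \<and> sum_list w = l. mpartial (sum_list w) f (x s) * wcoeff w * A s t w)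
      = mpartial l f (x s) * divmon (x t - x s) l"
      using l assms rough_path_compositions[OF assms(1-3), of l] by simp
  qed
  finally show ?thesis by (simp add: taylor_def less_Suc_eq_le)
qed

text \<open>The bound in the definition of a rough path concerns distinct times only. On the diagonal, Chen's relation
expresses the value on \<open>w\<close> through proper prefixes and suffixes, where it is zero by induction, and twice
itself.\<close>

lemma rough_path_diagonal:
  assumes "t \<in> {0..T}" "A t t [] = 1" "w \<in> trunc_words \<gamma> N" "w \<noteq> []"
  shows "A t t w = 0"
  using assms(3,4)
proof (induction w rule: length_induct)
  case (1 w)
  have "A t t w = (\<Sum>i\<le>length w. A t t (take i w) * A t t (drop i w))"
    using 1 assms by (intro chen) auto
  also have "\<dots> = (\<Sum>i\<in>{0, length w}. A t t (take i w) * A t t (drop i w))"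
  proof (intro sum.mono_neutral_right ballI)
    fix i assume "i \<in> {..length w} - {0, length w}"
    then have "length (take i w) < length w" "take i w \<noteq> []" by auto
    then have "A t t (take i w) = 0" using 1 take_drop_trunc_words(1) by blast
    then show "A t t (take i w) * A t t (drop i w) = 0" by simp
  qed auto
  also have "\<dots> = 2 * A t t w" using 1 assms(2) by simp
  finally show ?case by simp
qed

lemma rough_path_bound:
  assumes "\<And>t. t \<in> {0..T} \<Longrightarrow> A t t [] = 1" "w \<in> trunc_words \<gamma> N" "w \<noteq> []"
  shows "\<exists>B\<ge>0. \<forall>s\<in>{0..T}. \<forall>t\<in>{0..T}. \<bar>A s t w\<bar> \<le> B * \<bar>t - s\<bar> powr (\<gamma> * real (weight w))"
proof -
  let ?e = "\<gamma> * real (weight w)"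
  have "bdd_above {\<bar>A s t w\<bar> * \<bar>t - s\<bar> powr (- ?e) |s t. s \<in> {0..T} \<and> t \<in> {0..T} \<and> s \<noteq> t}"
  proof -
    have "\<forall>w\<in>words \<gamma>. weight w \<le> N \<longrightarrow>
        bdd_above {\<bar>A s t w\<bar> * \<bar>t - s\<bar> powr (- (\<gamma> * real (weight w))) |s t.
                     s \<in> {0..T} \<and> t \<in> {0..T} \<and> s \<noteq> t}"
      using rp unfolding quasi_geometric_rough_path_def by (elim conjE)
    then show ?thesis using assms(2) by simp
  qed
  then obtain B where B: "\<And>s t. s \<in> {0..T} \<Longrightarrow> t \<in> {0..T} \<Longrightarrow> s \<noteq> t \<Longrightarrow> \<bar>A s t w\<bar> * \<bar>t - s\<bar> powr (- ?e) \<le> B"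
    unfolding bdd_above_def by blast
  have "\<bar>A s t w\<bar> \<le> max B 0 * \<bar>t - s\<bar> powr ?e" if st: "s \<in> {0..T}" "t \<in> {0..T}" for s t
  proof (cases "s = t")
    case True
    then show ?thesis using rough_path_diagonal[OF st(2) assms(1)[OF st(2)] assms(2,3)] by simp
  next
    case False
    then have "\<bar>A s t w\<bar> = (\<bar>A s t w\<bar> * \<bar>t - s\<bar> powr (- ?e)) * \<bar>t - s\<bar> powr ?e"
      by (simp add: mult.assoc flip: powr_add)
    also have "\<dots> \<le> max B 0 * \<bar>t - s\<bar> powr ?e"
      using B[OF st False] by (intro mult_right_mono) auto
    finally show ?thesis .
  qed
  then show ?thesis by (intro exI[of _ "max B 0"]) auto
qed

section \<open>Germs of the rough integrals\<close>

text \<open>The summand of the rough sum that defines the integral against the letter \<open>k\<close>, after the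
coefficient of a word in the composed path has been computed.\<close>

definition germ :: "('d point \<Rightarrow> real) \<Rightarrow> 'd mindex \<Rightarrow> real \<Rightarrow> real \<Rightarrow> real" where
  "germ \<phi> k u v = (\<Sum>w\<in>trunc_words \<gamma> (N - mdeg k).
     mpartial (k + sum_list w) \<phi> (x u) * wcoeff w * A u v (w @ [k]))"

text \<open>A word occurs only in the divided power of the multi-index it sums up to, so a single term of the
composition contributes.\<close>

lemma lookup_deriv_path:
  assumes "\<phi> \<in> Cb (N + 1)" "mdeg k \<le> N" "w \<in> trunc_words \<gamma> (N - mdeg k)"
  shows "Poly_Mapping.lookup (deriv_path \<gamma> \<phi> x k u) w = mpartial (k + sum_list w) \<phi> (x u) * wcoeff w"
proof -
  let ?M = "N + 1 - mdeg k"
  have wM: "weight w < ?M" using assms by auto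
  have proj: "Poly_Mapping.lookup (proj_less M y) w = (if weight w < M then Poly_Mapping.lookup y w else 0)"
    for M and y :: "'d word \<Rightarrow>\<^sub>0 real"
    unfolding proj_less_def by (subst lookup_sum_word_vec) (auto simp: in_keys_iff)
  have "Poly_Mapping.lookup (deriv_path \<gamma> \<phi> x k u) w
    = (\<Sum>l | mdeg l < ?M. mpartial l (mpartial k \<phi>) (x u) / real (mfact l) *
        Poly_Mapping.lookup (qsh_monomial \<gamma> l) w)"
    using wM by (simp add: deriv_path_def compose_path_def lookup_sum lookup_scaleR proj)
  also have "\<dots> = (\<Sum>l | mdeg l < ?M. if sum_list w = l then mpartial l (mpartial k \<phi>) (x u) * wcoeff w else 0)"
    using assms(3)
    by (intro sum.cong refl) (auto simp: qsh_monomial_divpow[OF N1] lookup_scaleR lookup_divpow compositions_def)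
  also have "\<dots> = mpartial (sum_list w) (mpartial k \<phi>) (x u) * wcoeff w"
    using wM by (subst sum.delta') (auto simp: weight_conv_mdeg)
  also have "mpartial (sum_list w) (mpartial k \<phi>) = mpartial (k + sum_list w) \<phi>"
  proof (rule mpartial_mpartial)
    have "mdeg k + mdeg (sum_list w) \<le> N + 1" using wM by (simp add: weight_conv_mdeg)
    then show "\<phi> \<in> Cb (mdeg k + mdeg (sum_list w))" using assms(1) Cb_le by blast
  qed
  finally show ?thesis .
qed

lemma rough_sum_germ:
  assumes "\<phi> \<in> Cb (N + 1)" "mdeg k \<le> N"
  shows "rough_sum \<gamma> X k (deriv_path \<gamma> \<phi> x k) ts = psum (germ \<phi> k) ts"
  unfolding rough_sum_def psum_conv_nth germ_def
  by (intro sum.cong refl arg_cong2[where f = "(*)"] lookup_deriv_path[OF assms]) auto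

lemma finite_trunc_words: "finite (trunc_words \<gamma> n :: 'd word set)"
  by (rule finite_words_weight_le)

text \<open>The words \<open>w @ [k]\<close> exhaust the nonempty words, each exactly once, and the coefficient of the germ for
\<open>k\<close>, divided by \<open>k!\<close>, depends only on the whole word \<open>w @ [k]\<close>. Hence the sum is the Taylor expansion
without its term of order zero.\<close>

lemma sum_germs_taylor:
  assumes st: "s \<in> {0..T}" "t \<in> {0..T}" "A s t [] = 1"
  shows "(\<Sum>k | 1 \<le> mdeg k \<and> mdeg k \<le> N. 1 / real (mfact k) * germ \<phi> k s t)
    = taylor (N + 1) \<phi> (x s) (x t - x s) - \<phi> (x s)"
proof -
  let ?g = "\<lambda>w. mpartial (sum_list w) \<phi> (x s) * wcoeff w * A s t w"
  let ?K = "{k :: 'd mindex. 1 \<le> mdeg k \<and> mdeg k \<le> N}"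
  have K: "?K = alphabet \<gamma>" by (auto simp: alphabet_def Suc_le_eq simp flip: mdeg_eq_0_iff)
  have deg: "mdeg k \<le> N \<and> Suc 0 \<le> mdeg k" if "k \<in> alphabet \<gamma>" for k :: "'d mindex"
    using that unfolding K[symmetric] by simp
  have "(\<Sum>k\<in>?K. 1 / real (mfact k) * germ \<phi> k s t)
    = (\<Sum>k\<in>?K. \<Sum>w\<in>trunc_words \<gamma> (N - mdeg k). ?g (w @ [k]))"
    by (simp add: germ_def sum_distrib_left add.commute mult_ac)
  also have "\<dots> = (\<Sum>(k, w)\<in>Sigma ?K (\<lambda>k. trunc_words \<gamma> (N - mdeg k)). ?g (w @ [k]))"
    by (rule sum.Sigma) (simp_all add: K finite_trunc_words)
  also have "\<dots> = (\<Sum>w\<in>trunc_words \<gamma> N - {[]}. ?g w)"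
  proof (rule sum.reindex_bij_witness[of _ "\<lambda>w. (last w, butlast w)" "\<lambda>(k, w). w @ [k]"], goal_cases)
    case (2 a)
    then show ?case unfolding K using deg[of "fst a"] by auto
  next
    case (3 w)
    then show ?case by (cases w rule: rev_cases) auto
  next
    case (4 w)
    then show ?case unfolding K using deg by (cases w rule: rev_cases) auto
  qed auto
  also have "\<dots> = (\<Sum>w\<in>trunc_words \<gamma> N. ?g w) - ?g []"
    by (subst sum_diff1[OF finite_trunc_words]) auto
  also have "(\<Sum>w\<in>trunc_words \<gamma> N. ?g w) = taylor (N + 1) \<phi> (x s) (x t - x s)"
    using rough_path_taylor[OF st order_refl] by simp
  finally show ?thesis using st(3) by simp
qed

text \<open>Chen's relation splits each word \<open>w\<close> into \<open>p @ q\<close>. The coefficients are multiplicative under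
concatenation, and for fixed \<open>q\<close> the sum over \<open>p\<close> is a Taylor polynomial of the derivative that belongs to
\<open>k\<close> and \<open>q\<close>, from \<open>x s\<close> to \<open>x u\<close>. The germ over \<open>[u, t]\<close> contains the exact value of that derivative at
\<open>x u\<close>, so only Taylor remainders are left.\<close>

lemma germ_almost_additive_identity:
  assumes "s \<in> {0..T}" "u \<in> {0..T}" "t \<in> {0..T}"
    and one: "A s u [] = 1" "A u t [] = 1" and k: "1 \<le> mdeg k" "mdeg k \<le> N"
    and \<phi>: "\<phi> \<in> Cb (N + 1)"
  shows "germ \<phi> k s t - germ \<phi> k s u - germ \<phi> k u t =
    (\<Sum>q\<in>trunc_words \<gamma> (N - mdeg k). wcoeff q * A u t (q @ [k]) *
      (taylor (N + 1 - mdeg k - weight q) (mpartial (k + sum_list q) \<phi>) (x s) (x u - x s)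
       - mpartial (k + sum_list q) \<phi> (x u)))"
proof -
  let ?n = "N - mdeg k"
  let ?W = "trunc_words \<gamma> ?n :: 'd word set"
  let ?D = "\<lambda>l. mpartial (k + l) \<phi> (x s)"
  let ?h = "\<lambda>p q. ?D (sum_list (p @ q)) * wcoeff (p @ q) * (A s u p * A u t (q @ [k]))"
  have ka: "k \<in> alphabet \<gamma>" using k by (auto simp: alphabet_def)
  have "A s t (w @ [k]) = (\<Sum>i\<le>length w. A s u (take i w) * A u t (drop i w @ [k])) + A s u (w @ [k])"
    if "w \<in> ?W" for w
  proof -
    have "w @ [k] \<in> trunc_words \<gamma> N" using that k ka by auto
    from chen[OF assms(1-3) this] show ?thesis using one(2) by simp
  qed
  then have "germ \<phi> k s t = (\<Sum>w\<in>?W. ?D (sum_list w) * wcoeff w *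
      ((\<Sum>i\<le>length w. A s u (take i w) * A u t (drop i w @ [k])) + A s u (w @ [k])))"
    unfolding germ_def by (intro sum.cong refl) auto
  then have "germ \<phi> k s t - germ \<phi> k s u = (\<Sum>w\<in>?W. \<Sum>i\<le>length w. ?h (take i w) (drop i w))"
    unfolding germ_def by (simp add: distrib_left sum.distrib sum_distrib_left)
  also have "\<dots> = (\<Sum>(w, i)\<in>Sigma ?W (\<lambda>w. {..length w}). ?h (take i w) (drop i w))"
    by (rule sum.Sigma) (simp_all add: finite_trunc_words)
  \<comment> \<open>A word with a cut position corresponds to its suffix \<open>q\<close> and its prefix \<open>p\<close>.\<close>
  also have "\<dots> = (\<Sum>(q, p)\<in>Sigma ?W (\<lambda>q. trunc_words \<gamma> (?n - weight q)). ?h p q)"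
  proof (rule sum.reindex_bij_witness[of _ "\<lambda>(q, p). (p @ q, length p)" "\<lambda>(w, i). (drop i w, take i w)"], goal_cases)
    case (2 a)
    obtain w i where a: "a = (w, i)" "w \<in> ?W" using 2 by auto
    have "weight (take i w) + weight (drop i w) = weight w"
      by (metis weight_simps(3) append_take_drop_id)
    then show ?case using a take_drop_trunc_words[of w \<gamma> ?n i] by auto
  next
    case (5 a)
    then show ?case by (auto simp del: sum_list.append sum_list_append wcoeff_simps(3))
  qed auto
  also have "\<dots> = (\<Sum>q\<in>?W. \<Sum>p\<in>trunc_words \<gamma> (?n - weight q). ?h p q)"
    by (rule sum.Sigma[symmetric]) (simp_all add: finite_trunc_words)
  also have "\<dots> = (\<Sum>q\<in>?W. wcoeff q * A u t (q @ [k]) *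
      taylor (N + 1 - mdeg k - weight q) (mpartial (k + sum_list q) \<phi>) (x s) (x u - x s))"
  proof (intro sum.cong refl)
    fix q assume q: "q \<in> ?W"
    have "?D (sum_list (p @ q)) = mpartial (sum_list p) (mpartial (k + sum_list q) \<phi>) (x s)"
      if p: "p \<in> trunc_words \<gamma> (?n - weight q)" for p
    proof -
      have "mdeg (k + sum_list q) + mdeg (sum_list p) \<le> N + 1"
        using p q k by (auto simp: weight_conv_mdeg)
      then have "mpartial (sum_list p) (mpartial (k + sum_list q) \<phi>)
          = mpartial (k + sum_list q + sum_list p) \<phi>"
        using \<phi> Cb_le by (intro mpartial_mpartial) blast
      then show ?thesis by (simp add: ac_simps)
    qed
    then have "(\<Sum>p\<in>trunc_words \<gamma> (?n - weight q). ?h p q) = (\<Sum>p\<in>trunc_words \<gamma> (?n - weight q).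
        (wcoeff q * A u t (q @ [k])) *
        (mpartial (sum_list p) (mpartial (k + sum_list q) \<phi>) (x s) * wcoeff p * A s u p))"
      by (intro sum.cong refl) simp
    also have "\<dots> = wcoeff q * A u t (q @ [k]) *
        taylor (Suc (?n - weight q)) (mpartial (k + sum_list q) \<phi>) (x s) (x u - x s)"
      unfolding sum_distrib_left[symmetric]
      by (subst rough_path_taylor[OF assms(1,2) one(1)]) auto
    also have "Suc (?n - weight q) = N + 1 - mdeg k - weight q" using q k by auto
    finally show "(\<Sum>p\<in>trunc_words \<gamma> (?n - weight q). ?h p q) = wcoeff q * A u t (q @ [k]) *
      taylor (N + 1 - mdeg k - weight q) (mpartial (k + sum_list q) \<phi>) (x s) (x u - x s)" .
  qed
  finally show ?thesis
    unfolding germ_def[of _ _ u t] by (simp add: right_diff_distrib sum_subtractf mult_ac)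
qed

text \<open>The form in which Hoelder continuity of the path meets the Taylor remainders. For \<open>s = t\<close> both sides are
zero because \<open>m > 0\<close>.\<close>

lemma holder_path_power:
  assumes "holder_path \<gamma> T x" "0 < \<gamma>"
  shows "\<exists>H\<ge>0. \<forall>s u t m. 0 \<le> s \<longrightarrow> s \<le> u \<longrightarrow> u \<le> t \<longrightarrow> t \<le> T \<longrightarrow> 0 < m \<longrightarrow>
    norm (x u - x s) ^ m \<le> H ^ m * (t - s) powr (\<gamma> * real m)"
proof -
  obtain H where H: "\<And>s t. s \<in> {0..T} \<Longrightarrow> t \<in> {0..T} \<Longrightarrow> norm (x t - x s) \<le> H * \<bar>t - s\<bar> powr \<gamma>"
    using assms(1) unfolding holder_path_def by blast
  have "norm (x u - x s) ^ m \<le> \<bar>H\<bar> ^ m * (t - s) powr (\<gamma> * real m)"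
    if st: "0 \<le> s" "s \<le> u" "u \<le> t" "t \<le> T" and m: "0 < m" for s u t m
  proof -
    have "norm (x u - x s) \<le> H * \<bar>u - s\<bar> powr \<gamma>" using st by (intro H) auto
    also have "\<dots> \<le> \<bar>H\<bar> * (t - s) powr \<gamma>"
      using st assms(2) by (intro mult_mono powr_mono2) auto
    finally have "norm (x u - x s) ^ m \<le> (\<bar>H\<bar> * (t - s) powr \<gamma>) ^ m"
      by (intro power_mono) auto
    moreover have "((t - s) powr \<gamma>) ^ m = (t - s) powr (\<gamma> * real m)"
    proof (cases "t = s")
      case False
      then show ?thesis using powr_power[of "t - s" \<gamma> m] by (simp add: mult.commute)
    qed (use m in simp)
    ultimately show ?thesis by (simp add: power_mult_distrib)
  qed
  then show ?thesis by (intro exI[of _ "\<bar>H\<bar>"]) auto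
qed

text \<open>In the term for \<open>q\<close> of \<open>germ_almost_additive_identity\<close>, the rough path contributes the order
\<open>\<gamma> * (weight q + |k|)\<close> and the Taylor remainder the order \<open>\<gamma> * (N + 1 - |k| - weight q)\<close>. The two add up
to \<open>\<gamma> * (N + 1)\<close>, for every \<open>q\<close>.\<close>

lemma germ_almost_additive:
  assumes one: "\<And>s t. s \<in> {0..T} \<Longrightarrow> t \<in> {0..T} \<Longrightarrow> A s t [] = 1"
    and x: "holder_path \<gamma> T x" and \<gamma>: "0 < \<gamma>"
    and \<phi>: "\<phi> \<in> Cb (N + 1)" and k: "1 \<le> mdeg k" "mdeg k \<le> N"
  shows "\<exists>C\<ge>0. \<forall>s u t. 0 \<le> s \<longrightarrow> s \<le> u \<longrightarrow> u \<le> t \<longrightarrow> t \<le> T \<longrightarrow>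
    \<bar>germ \<phi> k s t - germ \<phi> k s u - germ \<phi> k u t\<bar> \<le> C * (t - s) powr (\<gamma> * real (N + 1))"
proof -
  let ?W = "trunc_words \<gamma> (N - mdeg k) :: 'd word set"
  let ?m = "\<lambda>q. N + 1 - mdeg k - weight q"
  obtain H where H: "0 \<le> H" "\<And>s u t m. 0 \<le> s \<Longrightarrow> s \<le> u \<Longrightarrow> u \<le> t \<Longrightarrow> t \<le> T \<Longrightarrow> 0 < m \<Longrightarrow>
      norm (x u - x s) ^ m \<le> H ^ m * (t - s) powr (\<gamma> * real m)"
    using holder_path_power[OF x \<gamma>] by blast
  let ?P = "\<lambda>q C. 0 \<le> C \<and> (\<forall>s u t. 0 \<le> s \<longrightarrow> s \<le> u \<longrightarrow> u \<le> t \<longrightarrow> t \<le> T \<longrightarrow>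
      \<bar>wcoeff q * A u t (q @ [k]) *
      (taylor (?m q) (mpartial (k + sum_list q) \<phi>) (x s) (x u - x s) - mpartial (k + sum_list q) \<phi> (x u))\<bar>
      \<le> C * (t - s) powr (\<gamma> * real (N + 1)))"
  have "\<exists>C. ?P q C" if q: "q \<in> ?W" for q
  proof -
    have m: "0 < ?m q" "weight (q @ [k]) + ?m q = N + 1" using q k by auto
    have "\<phi> \<in> Cb (?m q + mdeg (k + sum_list q))"
      using m \<phi> by (simp add: weight_conv_mdeg[symmetric] add_ac)
    then have "mpartial (k + sum_list q) \<phi> \<in> Cb (?m q)" by (rule mpartial_Cb)
    then obtain E where E: "0 \<le> E" "\<And>y z. \<bar>mpartial (k + sum_list q) \<phi> z
        - taylor (?m q) (mpartial (k + sum_list q) \<phi>) y (z - y)\<bar> \<le> E * norm (z - y) ^ ?m q"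
      using taylor_remainder by blast
    have "q @ [k] \<in> trunc_words \<gamma> N" using q k by (auto simp: alphabet_def)
    then obtain B where B: "0 \<le> B" "\<And>s t. s \<in> {0..T} \<Longrightarrow> t \<in> {0..T} \<Longrightarrow>
        \<bar>A s t (q @ [k])\<bar> \<le> B * \<bar>t - s\<bar> powr (\<gamma> * real (weight (q @ [k])))"
      using rough_path_bound[of "q @ [k]"] one by blast
    have "\<bar>wcoeff q * A u t (q @ [k]) *
      (taylor (?m q) (mpartial (k + sum_list q) \<phi>) (x s) (x u - x s) - mpartial (k + sum_list q) \<phi> (x u))\<bar>
      \<le> \<bar>wcoeff q\<bar> * B * (E * H ^ ?m q) * (t - s) powr (\<gamma> * real (N + 1))"
      if st: "0 \<le> s" "s \<le> u" "u \<le> t" "t \<le> T" for s u t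
    proof -
      have in0T: "s \<in> {0..T}" "u \<in> {0..T}" "t \<in> {0..T}" using st by auto
      have "\<bar>A u t (q @ [k])\<bar> \<le> B * \<bar>t - u\<bar> powr (\<gamma> * real (weight (q @ [k])))"
        by (rule B(2)[OF in0T(2,3)])
      also have "\<dots> \<le> B * (t - s) powr (\<gamma> * real (weight (q @ [k])))"
        using st B(1) \<gamma> by (intro mult_left_mono powr_mono2) auto
      finally have 1: "\<bar>A u t (q @ [k])\<bar> \<le> B * (t - s) powr (\<gamma> * real (weight (q @ [k])))" .
      have "E * norm (x u - x s) ^ ?m q \<le> E * (H ^ ?m q * (t - s) powr (\<gamma> * real (?m q)))"
        using E(1) H(2)[OF st m(1)] by (intro mult_left_mono)
      then have 2: "\<bar>taylor (?m q) (mpartial (k + sum_list q) \<phi>) (x s) (x u - x s) - mpartial (k + sum_list q) \<phi> (x u)\<bar>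
          \<le> E * (H ^ ?m q * (t - s) powr (\<gamma> * real (?m q)))"
        using E(2)[of "x u" "x s"] by (simp add: abs_minus_commute)
      have "\<gamma> * real (N + 1) = \<gamma> * real (weight (q @ [k])) + \<gamma> * real (?m q)"
        by (simp only: m(2) flip: of_nat_add distrib_left)
      then have 3: "(t - s) powr (\<gamma> * real (N + 1))
          = (t - s) powr (\<gamma> * real (weight (q @ [k]))) * (t - s) powr (\<gamma> * real (?m q))"
        by (simp only: powr_add)
      have "\<bar>A u t (q @ [k])\<bar> * \<bar>taylor (?m q) (mpartial (k + sum_list q) \<phi>) (x s) (x u - x s) - mpartial (k + sum_list q) \<phi> (x u)\<bar>
        \<le> (B * (t - s) powr (\<gamma> * real (weight (q @ [k])))) * (E * (H ^ ?m q * (t - s) powr (\<gamma> * real (?m q))))"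
        using 1 2 B(1) by (intro mult_mono) auto
      then have "\<bar>wcoeff q\<bar> * (\<bar>A u t (q @ [k])\<bar> * \<bar>taylor (?m q) (mpartial (k + sum_list q) \<phi>) (x s) (x u - x s) - mpartial (k + sum_list q) \<phi> (x u)\<bar>)
        \<le> \<bar>wcoeff q\<bar> * ((B * (t - s) powr (\<gamma> * real (weight (q @ [k])))) * (E * (H ^ ?m q * (t - s) powr (\<gamma> * real (?m q)))))"
        by (rule mult_left_mono) simp
      then show ?thesis unfolding 3 abs_mult by (simp only: mult_ac)
    qed
    then show ?thesis using B(1) E(1) H(1) by (intro exI[of _ "\<bar>wcoeff q\<bar> * B * (E * H ^ ?m q)"]) auto
  qed
  then have "\<forall>q\<in>?W. \<exists>C. ?P q C" by (intro ballI)
  then have "\<exists>C. \<forall>q\<in>?W. ?P q (C q)" by (rule bchoice)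
  then obtain C where C: "\<And>q. q \<in> ?W \<Longrightarrow> ?P q (C q)" by blast
  show ?thesis
  proof (intro exI[of _ "\<Sum>q\<in>?W. C q"] conjI allI impI)
    show "0 \<le> (\<Sum>q\<in>?W. C q)" by (rule sum_nonneg) (use C in blast)
    fix s u t :: real assume st: "0 \<le> s" "s \<le> u" "u \<le> t" "t \<le> T"
    then have in0T: "s \<in> {0..T}" "u \<in> {0..T}" "t \<in> {0..T}" by auto
    show "\<bar>germ \<phi> k s t - germ \<phi> k s u - germ \<phi> k u t\<bar> \<le> (\<Sum>q\<in>?W. C q) * (t - s) powr (\<gamma> * real (N + 1))"
      unfolding germ_almost_additive_identity[OF in0T one[OF in0T(1,2)] one[OF in0T(2,3)] k \<phi>]
        sum_distrib_right
      by (rule order_trans[OF sum_abs], rule sum_mono) (use C st in blast)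
  qed
qed

lemma germ_zero:
  fixes k :: "'d mindex"
  assumes "\<And>w. w \<in> trunc_words \<gamma> N \<Longrightarrow> A s t w = 0" "1 \<le> mdeg k" "mdeg k \<le> N"
  shows "germ \<phi> k s t = 0"
  unfolding germ_def
proof (intro sum.neutral ballI)
  fix w :: "'d word" assume "w \<in> trunc_words \<gamma> (N - mdeg k)"
  then have "w @ [k] \<in> trunc_words \<gamma> N" using assms(2,3) by (auto simp: alphabet_def)
  then show "mpartial (k + sum_list w) \<phi> (x s) * wcoeff w * A s t (w @ [k]) = 0"
    using assms(1) by simp
qed

lemma germ_sewable:
  assumes x: "holder_path \<gamma> T x" and \<gamma>: "0 < \<gamma>"
    and \<phi>: "\<phi> \<in> Cb (N + 1)" and k: "1 \<le> mdeg k" "mdeg k \<le> N"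
  shows "\<exists>C\<ge>0. \<forall>s u t. 0 \<le> s \<longrightarrow> s \<le> u \<longrightarrow> u \<le> t \<longrightarrow> t \<le> T \<longrightarrow>
    \<bar>germ \<phi> k s t - germ \<phi> k s u - germ \<phi> k u t\<bar> \<le> C * (t - s) powr (\<gamma> * real (N + 1))"
  using rough_path_dichotomy
proof
  assume "\<forall>s\<in>{0..T}. \<forall>t\<in>{0..T}. A s t [] = 1"
  then show ?thesis using germ_almost_additive[OF _ assms] by blast
next
  assume "\<forall>s\<in>{0..T}. \<forall>t\<in>{0..T}. \<forall>w\<in>trunc_words \<gamma> N. A s t w = 0"
  then have "germ \<phi> k s t = 0" if "s \<in> {0..T}" "t \<in> {0..T}" for s t
    using that germ_zero[OF _ k] by blast
  then show ?thesis by (intro exI[of _ 0]) auto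
qed

text \<open>In the nondegenerate case this is Taylor's formula for \<open>\<phi>\<close>; in the degenerate one both terms are zero.\<close>

lemma germs_near_increment:
  assumes x: "holder_path \<gamma> T x" and \<gamma>: "0 < \<gamma>" and \<phi>: "\<phi> \<in> Cb (N + 1)"
  shows "\<exists>C\<ge>0. \<forall>u v. 0 \<le> u \<longrightarrow> u \<le> v \<longrightarrow> v \<le> T \<longrightarrow>
    \<bar>(\<Sum>k | 1 \<le> mdeg k \<and> mdeg k \<le> N. 1 / real (mfact k) * germ \<phi> k u v) - (\<phi> (x v) - \<phi> (x u))\<bar>
      \<le> C * (v - u) powr (\<gamma> * real (N + 1))"
  using rough_path_dichotomy
proof
  assume one: "\<forall>s\<in>{0..T}. \<forall>t\<in>{0..T}. A s t [] = 1"
  obtain H where H: "0 \<le> H" "\<And>s u t m. 0 \<le> s \<Longrightarrow> s \<le> u \<Longrightarrow> u \<le> t \<Longrightarrow> t \<le> T \<Longrightarrow> 0 < m \<Longrightarrow>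
      norm (x u - x s) ^ m \<le> H ^ m * (t - s) powr (\<gamma> * real m)"
    using holder_path_power[OF x \<gamma>] by blast
  obtain E where E: "0 \<le> E"
    "\<And>y z. \<bar>\<phi> z - taylor (N + 1) \<phi> y (z - y)\<bar> \<le> E * norm (z - y) ^ (N + 1)"
    using taylor_remainder[OF \<phi>] by blast
  have "\<bar>(\<Sum>k | 1 \<le> mdeg k \<and> mdeg k \<le> N. 1 / real (mfact k) * germ \<phi> k u v) - (\<phi> (x v) - \<phi> (x u))\<bar>
      \<le> E * H ^ (N + 1) * (v - u) powr (\<gamma> * real (N + 1))" if uv: "0 \<le> u" "u \<le> v" "v \<le> T" for u v
  proof -
    have in0T: "u \<in> {0..T}" "v \<in> {0..T}" using uv by auto
    then have Auv: "A u v [] = 1" using one by blast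
    have "\<bar>(\<Sum>k | 1 \<le> mdeg k \<and> mdeg k \<le> N. 1 / real (mfact k) * germ \<phi> k u v) - (\<phi> (x v) - \<phi> (x u))\<bar>
        = \<bar>\<phi> (x v) - taylor (N + 1) \<phi> (x u) (x v - x u)\<bar>"
      unfolding sum_germs_taylor[OF in0T Auv] by simp
    also have "\<dots> \<le> E * norm (x v - x u) ^ (N + 1)" by (rule E)
    also have "\<dots> \<le> E * (H ^ (N + 1) * (v - u) powr (\<gamma> * real (N + 1)))"
      using uv by (intro mult_left_mono H E) auto
    finally show ?thesis by (simp only: mult.assoc)
  qed
  then show ?thesis using E(1) H(1) by (intro exI[of _ "E * H ^ (N + 1)"]) auto
next
  assume z: "\<forall>s\<in>{0..T}. \<forall>t\<in>{0..T}. \<forall>w\<in>trunc_words \<gamma> N. A s t w = 0"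
  have "\<bar>(\<Sum>k | 1 \<le> mdeg k \<and> mdeg k \<le> N. 1 / real (mfact k) * germ \<phi> k u v) - (\<phi> (x v) - \<phi> (x u))\<bar> = 0"
    if "0 \<le> u" "u \<le> v" "v \<le> T" for u v
  proof -
    have in0T: "u \<in> {0..T}" "v \<in> {0..T}" using that by auto
    have "x v $ i = x u $ i" for i
    proof -
      have "[axis i 1] \<in> trunc_words \<gamma> N"
        using N1 by (auto simp: alphabet_def simp flip: mdeg_eq_0_iff)
      then show ?thesis using z in0T over[OF in0T, of i] by force
    qed
    then have "x v = x u" by (simp add: vec_eq_iff)
    moreover have "germ \<phi> k u v = 0" if "1 \<le> mdeg k" "mdeg k \<le> N" for k
      using that z in0T by (intro germ_zero) auto
    ultimately show ?thesis by simp
  qed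
  then show ?thesis by (intro exI[of _ 0]) auto
qed

end

text \<open>The second inequality is the point of the choice of \<open>Ngam \<gamma>\<close>: the sum of errors of order
\<open>\<gamma> * (Ngam \<gamma> + 1)\<close> over a partition vanishes with its mesh.\<close>

lemma Ngam_bounds: "0 < \<gamma> \<Longrightarrow> \<gamma> < 1 \<Longrightarrow> 1 \<le> Ngam \<gamma> \<and> 1 < \<gamma> * real (Ngam \<gamma> + 1)"
proof -
  assume g: "0 < \<gamma>" "\<gamma> < 1"
  then have i: "1 < inverse \<gamma>" by (simp add: one_less_inverse)
  then have "1 \<le> Ngam \<gamma>" unfolding Ngam_def by linarith
  moreover have "inverse \<gamma> < real (Ngam \<gamma> + 1)" unfolding Ngam_def using i by linarith
  then have "\<gamma> * inverse \<gamma> < \<gamma> * real (Ngam \<gamma> + 1)" using g by (intro mult_strict_left_mono)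
  ultimately show ?thesis using g by simp
qed

section \<open>The change of variables formula\<close>

theorem theorem4p20:
  fixes \<gamma> T :: real
    and x :: "real \<Rightarrow> ('d::{finite,linorder}) point"
    and X :: "real \<Rightarrow> real \<Rightarrow> ('d word \<Rightarrow>\<^sub>0 real) \<Rightarrow> real"
    and \<phi> :: "'d point \<Rightarrow> real"
  assumes "0 < \<gamma>" and "\<gamma> < 1"
    and "holder_path \<gamma> T x"
    and "quasi_geometric_rough_path \<gamma> T X"
    and "\<And>s t i. s \<in> {0..T} \<Longrightarrow> t \<in> {0..T} \<Longrightarrow> X s t (word_vec [axis i 1]) = x t $ i - x s $ i"
    and "\<phi> \<in> Cb (Ngam \<gamma> + 1)"
    and "s \<in> {0..T}" and "t \<in> {0..T}"
  shows "(\<forall>k. 1 \<le> mdeg k \<and> mdeg k \<le> Ngam \<gamma> \<longrightarrow>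
            (\<forall>r\<in>{0..T}. rough_integrable \<gamma> X k (deriv_path \<gamma> \<phi> x k) r)) \<and>
         \<phi> (x t) = \<phi> (x s) +
           (\<Sum>n = 1..Ngam \<gamma>. \<Sum>k | mdeg k = n.
              1 / real (mfact k) * rough_integral \<gamma> X k (deriv_path \<gamma> \<phi> x k) s t)"
proof -
  let ?N = "Ngam \<gamma>"
  let ?K = "{k :: 'd mindex. 1 \<le> mdeg k \<and> mdeg k \<le> ?N}"
  let ?S = "\<lambda>k. rough_sum \<gamma> X k (deriv_path \<gamma> \<phi> x k)"
  let ?L = "\<lambda>k r. Lim (mesh_filter r) (?S k)"
  have N1: "1 \<le> ?N" and \<theta>: "1 < \<gamma> * real (?N + 1)"
    using Ngam_bounds[OF assms(1,2)] by auto
  define G where "G = germ \<gamma> x X \<phi>"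
  have S: "?S k = psum (G k)" if "k \<in> ?K" for k
    unfolding G_def using that by (intro ext rough_sum_germ[OF N1 assms(4,5,6)]) auto
  have ex: "\<exists>I. (?S k \<longlongrightarrow> I) (mesh_filter r)" if k: "k \<in> ?K" and r: "r \<in> {0..T}" for k r
  proof -
    obtain C where "0 \<le> C" "\<And>s u t. 0 \<le> s \<Longrightarrow> s \<le> u \<Longrightarrow> u \<le> t \<Longrightarrow> t \<le> T \<Longrightarrow>
        \<bar>G k s t - G k s u - G k u t\<bar> \<le> C * (t - s) powr (\<gamma> * real (?N + 1))"
      using germ_sewable[OF N1 assms(4,5,3,1,6)] k unfolding G_def by blast
    then show ?thesis unfolding S[OF k] by (intro sewing[OF \<theta> _ r])
  qed
  have lim: "(?S k \<longlongrightarrow> ?L k r) (mesh_filter r)" if kr: "k \<in> ?K" "r \<in> {0..T}" for k r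
  proof -
    obtain I where I: "(?S k \<longlongrightarrow> I) (mesh_filter r)" using ex[OF kr] by blast
    moreover have "?L k r = I" using kr(2) by (intro tendsto_Lim I mesh_filter_neq_bot) auto
    ultimately show ?thesis by simp
  qed
  have total: "(\<Sum>k\<in>?K. 1 / real (mfact k) * ?L k r) = \<phi> (x r) - \<phi> (x 0)" if r: "r \<in> {0..T}" for r
  proof (rule tendsto_unique)
    show "mesh_filter r \<noteq> bot" using r by (intro mesh_filter_neq_bot) auto
    obtain C where "0 \<le> C" "\<And>u v. 0 \<le> u \<Longrightarrow> u \<le> v \<Longrightarrow> v \<le> T \<Longrightarrow>
        \<bar>(\<Sum>k\<in>?K. 1 / real (mfact k) * G k u v) - (\<phi> (x v) - \<phi> (x u))\<bar>
          \<le> C * (v - u) powr (\<gamma> * real (?N + 1))"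
      using germs_near_increment[OF N1 assms(4,5,3,1,6)] unfolding G_def by blast
    then show "(psum (\<lambda>u v. \<Sum>k\<in>?K. 1 / real (mfact k) * G k u v) \<longlongrightarrow> \<phi> (x r) - \<phi> (x 0)) (mesh_filter r)"
      by (intro psum_tendsto_increment[OF \<theta> _ r, of C _ "\<lambda>r. \<phi> (x r)"])
    have "psum (\<lambda>u v. \<Sum>k\<in>?K. 1 / real (mfact k) * G k u v) = (\<lambda>ts. \<Sum>k\<in>?K. 1 / real (mfact k) * ?S k ts)"
      unfolding psum_sum psum_cmult using S by (intro ext sum.cong) auto
    then show "(psum (\<lambda>u v. \<Sum>k\<in>?K. 1 / real (mfact k) * G k u v)
        \<longlongrightarrow> (\<Sum>k\<in>?K. 1 / real (mfact k) * ?L k r)) (mesh_filter r)"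
      using lim[OF _ r] by (simp only:) (intro tendsto_sum tendsto_mult tendsto_const)
  qed
  have "(\<Sum>n = 1..?N. \<Sum>k | mdeg k = n. 1 / real (mfact k) * (?L k t - ?L k s))
      = (\<Sum>n = 1..?N. \<Sum>k | k \<in> ?K \<and> mdeg k = n. 1 / real (mfact k) * (?L k t - ?L k s))"
    by (intro sum.cong) auto
  also have "\<dots> = (\<Sum>k\<in>?K. 1 / real (mfact k) * (?L k t - ?L k s))"
    by (rule sum.group) (auto intro: finite_subset[OF _ finite_mdeg_le[of ?N]])
  also have "\<dots> = \<phi> (x t) - \<phi> (x s)"
    using total[OF assms(7)] total[OF assms(8)] by (simp add: right_diff_distrib sum_subtractf)
  finally show ?thesis using ex unfolding rough_integrable_def rough_integral_def by auto
qed

end
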